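(* Let $\mathcal H$ be the decorated Connes–Kreimer Hopf algebra described below, let $T_0$ be a rooted tree in it on $n_0$ vertices whose non-root vertices carry pairwise distinct labels, and consider the Markov chains on $\mathcal B_{n_0}$ driven by $\mathrm{T2R}_{n_0}$ and by $\mathrm{BinT2R}_{n_0}(q_2)$ started at $T_0$. These chains remain in the set $\{\bullet^{n_0-n}\sqcup T: T \text{ a rooted subtree of } T_0 \text{ on } n \text{ vertices},\ 1\le n\le n_0\}$, and under the identification $\bullet^{n_0-n}\sqcup T\mapsto T$ the chain driven by $\mathrm{T2R}_{n_0}$ is the single model and the chain driven by $\mathrm{BinT2R}_{n_0}(q_2)$ is the binomial model (with parameter $q_2$) of the employee-firing chain started at $T_0$.
   Context: $\mathcal H$: basis $\mathcal B$ of rooted forests in which every non-root vertex carries a label from a fixed finite set (roots unlabelled), graded by number of vertices; $\bullet$ is the one-vertex forest. Product is disjoint union $\sqcup$ (labels preserved). For a forest $x$ on $m$ vertices, $\Delta_{1,m-1}(x)=\sum_v\bullet\otimes(x\setminus v)$ over all leaves $v$ of $x$ (vertices without children, including isolated roots), labels preserved; consequently $\Delta_{1^r,m-r}(x)=\sum\bullet^{\otimes r}\otimes x\setminus\{v_1,\dots,v_r\}$ over sequences with $v_i$ a leaf of $x\setminus\{v_1,\dots,v_{i-1}\}$, and $m\Delta_{1^r,m-r}$ is this followed by multiplication. $\mathrm{T2R}_m=\frac1m m\Delta_{1,m-1}$; $\mathrm{BinT2R}_m(q_2)=\sum_{r=0}^m\frac1{r!}(1-q_2)^rq_2^{m-r}m\Delta_{1^r,m-r}$.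 $\eta(x)$ is the number of increasing labellings of $x$ (bijections from vertices to $\{1,\dots,m\}$ with each parent's number smaller than its children's). The chain driven by $\mathrm T$ has transition matrix $\hat K(x,y)=\frac{\eta(y)}{\eta(x)}\cdot(\text{coefficient of } y\text{ in }\mathrm T(x))$. A rooted subtree of $T_0$ is a connected set of vertices containing the root, with induced labels. Employee-firing chain (states: rooted subtrees of $T_0$; vertices are positions, root = boss, each occupied by one employee). Promotion cascade after the employee at vertex $v$ of the current tree $T$ is fired: set $u:=v$; while $u$ has children, choose $w$ uniformly among strict descendants of $u$, promote the employee at $w$ to $u$, set $u:=w$; finally delete the leaf $u$, giving $T$ minus that leaf. No firing occurs when only the boss remains. Single model: from a state with $n$ vertices, with probability $n/n_0$ a uniformly chosen employee is fired (with cascade), otherwise no change. Binomial model: each employee is independently fired with probability $1-q_2$, the fired employees being fired one by one in uniformly random order, each with its cascade. *)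

theory Defs
  imports
    "HOL-Probability.Probability"
    "HOL-Library.Poly_Mapping"
    "HOL-Combinatorics.Multiset_Permutations"
begin

section \<open>Decorated rooted forests\<close>

text \<open>Only the values of \<open>par\<close> and \<open>lab\<close> on \<open>verts\<close> are meaningful. A root has parent \<open>None\<close> and
  label \<open>None\<close>. The induced sub-forest on a parent-closed set \<open>S\<close> is \<open>F\<lparr>verts := S\<rparr>\<close>.\<close>

record 'l dforest =
  verts :: "nat set"
  par :: "nat \<Rightarrow> nat option"
  lab :: "nat \<Rightarrow> 'l option"

definition child_rel :: "'l dforest \<Rightarrow> (nat \<times> nat) set" where
  "child_rel F = {(u, v). v \<in> verts F \<and> par F v = Some u}"

definition wf_forest :: "'l dforest \<Rightarrow> bool" where
  "wf_forest F \<longleftrightarrow>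
     finite (verts F) \<and>
     (\<forall>v\<in>verts F. \<forall>u. par F v = Some u \<longrightarrow> u \<in> verts F) \<and>
     acyclic (child_rel F) \<and>
     (\<forall>v\<in>verts F. lab F v = None \<longleftrightarrow> par F v = None)"

definition children :: "'l dforest \<Rightarrow> nat \<Rightarrow> nat set" where
  "children F u = child_rel F `` {u}"

definition strict_desc :: "'l dforest \<Rightarrow> nat \<Rightarrow> nat set" where
  "strict_desc F u = (child_rel F)\<^sup>+ `` {u}"

definition leaves :: "'l dforest \<Rightarrow> nat set" where
  "leaves F = {v \<in> verts F. children F v = {}}"

definition del_vertex :: "'l dforest \<Rightarrow> nat \<Rightarrow> 'l dforest" where
  "del_vertex F v = F\<lparr>verts := verts F - {v}\<rparr>"

definition inc_labellings :: "'l dforest \<Rightarrow> (nat \<Rightarrow> nat) set" where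
  "inc_labellings F =
     {f \<in> extensional (verts F). bij_betw f (verts F) {1..card (verts F)} \<and>
        (\<forall>(u, v)\<in>child_rel F. f u < f v)}"

definition forest_iso_by :: "(nat \<Rightarrow> nat) \<Rightarrow> 'l dforest \<Rightarrow> 'l dforest \<Rightarrow> bool" where
  "forest_iso_by f F G \<longleftrightarrow>
     bij_betw f (verts F) (verts G) \<and>
     (\<forall>v\<in>verts F. par G (f v) = map_option f (par F v) \<and> lab G (f v) = lab F v)"

definition forest_iso :: "'l dforest \<Rightarrow> 'l dforest \<Rightarrow> bool" where
  "forest_iso F G \<longleftrightarrow> wf_forest F \<and> wf_forest G \<and> (\<exists>f. forest_iso_by f F G)"

definition empty_df :: "'l dforest" where
  "empty_df = \<lparr>verts = {}, par = (\<lambda>_. None), lab = (\<lambda>_. None)\<rparr>"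

definition dot_df :: "'l dforest" where
  "dot_df = \<lparr>verts = {0}, par = (\<lambda>_. None), lab = (\<lambda>_. None)\<rparr>"

definition disj_union :: "'l dforest \<Rightarrow> 'l dforest \<Rightarrow> 'l dforest" where
  "disj_union F G =
     \<lparr>verts = (\<lambda>n. 2 * n) ` verts F \<union> (\<lambda>n. 2 * n + 1) ` verts G,
      par = (\<lambda>v. if even v then map_option (\<lambda>n. 2 * n) (par F (v div 2))
                 else map_option (\<lambda>n. 2 * n + 1) (par G (v div 2))),
      lab = (\<lambda>v. if even v then lab F (v div 2) else lab G (v div 2))\<rparr>"

lemma disj_union_simps:
  "verts (disj_union F G) = (\<lambda>n. 2 * n) ` verts F \<union> (\<lambda>n. Suc (2 * n)) ` verts G"
  "par (disj_union F G) (2 * n) = map_option (\<lambda>n. 2 * n) (par F n)"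
  "par (disj_union F G) (Suc (2 * n)) = map_option (\<lambda>n. Suc (2 * n)) (par G n)"
  "lab (disj_union F G) (2 * n) = lab F n"
  "lab (disj_union F G) (Suc (2 * n)) = lab G n"
  by (auto simp: disj_union_def)

lemma forest_iso_byI:
  assumes "f ` verts F = verts G" "inj_on f (verts F)"
    "\<And>v. v \<in> verts F \<Longrightarrow> par G (f v) = map_option f (par F v) \<and> lab G (f v) = lab F v"
  shows "forest_iso_by f F G"
  using assms by (simp add: forest_iso_by_def bij_betw_def)

lemma wf_forest_parD: "wf_forest F \<Longrightarrow> v \<in> verts F \<Longrightarrow> par F v = Some u \<Longrightarrow> u \<in> verts F"
  by (auto simp: wf_forest_def)

lemma wf_forest_finite: "wf_forest F \<Longrightarrow> finite (verts F)"
  by (auto simp: wf_forest_def)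

lemma child_rel_verts: "wf_forest F \<Longrightarrow> child_rel F \<subseteq> verts F \<times> verts F"
  by (auto simp: child_rel_def wf_forest_def)

lemma wf_child_rel: "wf_forest F \<Longrightarrow> wf (child_rel F)"
  using child_rel_verts[of F]
  by (meson finite_SigmaI finite_acyclic_wf finite_subset wf_forest_def)

lemma wf_forest_empty: "wf_forest empty_df"
  by (auto simp: wf_forest_def empty_df_def child_rel_def acyclic_def)

lemma wf_forest_dot: "wf_forest dot_df"
  by (auto simp: wf_forest_def dot_df_def child_rel_def acyclic_def)

lemma wf_forest_disj_union:
  assumes "wf_forest F" "wf_forest G"
  shows "wf_forest (disj_union F G)"
proof -
  let ?r = "inv_image (child_rel F) (\<lambda>v. v div 2) \<inter> ({v. even v} \<times> {v. even v})"
  let ?s = "inv_image (child_rel G) (\<lambda>v. v div 2) \<inter> ({v. odd v} \<times> {v. odd v})"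
  have "wf ?r" "wf ?s"
    using assms by (auto intro: wf_subset[OF wf_inv_image[OF wf_child_rel]])
  then have "wf (?r \<union> ?s)"
    by (intro wf_Un) auto
  moreover have "child_rel (disj_union F G) \<subseteq> ?r \<union> ?s"
    by (auto simp: child_rel_def disj_union_simps)
  ultimately have "acyclic (child_rel (disj_union F G))"
    by (meson wf_acyclic wf_subset)
  then show ?thesis
    using assms
    by (auto simp: wf_forest_def disj_union_simps)
qed

lemma forest_iso_by_child_rel:
  assumes "forest_iso_by f F G" "wf_forest F" "u \<in> verts F" "v \<in> verts F"
  shows "(f u, f v) \<in> child_rel G \<longleftrightarrow> (u, v) \<in> child_rel F"
proof -
  have "f v \<in> verts G" "inj_on f (verts F)" "par G (f v) = map_option f (par F v)"
    using assms by (auto simp: forest_iso_by_def bij_betw_def)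
  then show ?thesis
    using assms wf_forest_parD[OF assms(2,4)]
    by (auto simp: child_rel_def dest: inj_onD)
qed

lemma forest_iso_by_inv:
  assumes f: "forest_iso_by f F G" and wfs: "wf_forest F"
  shows "forest_iso_by (inv_into (verts F) f) G F"
proof -
  let ?g = "inv_into (verts F) f"
  have b: "bij_betw f (verts F) (verts G)" using f by (simp add: forest_iso_by_def)
  have "par F (?g w) = map_option ?g (par G w) \<and> lab F (?g w) = lab G w" if w: "w \<in> verts G" for w
  proof -
    obtain v where v: "v \<in> verts F" "w = f v" using w b by (auto simp: bij_betw_def)
    have g: "?g (f u) = u" if "u \<in> verts F" for u
      using b that by (simp add: bij_betw_inv_into_left)
    show ?thesis
      using v f g wf_forest_parD[OF wfs v(1)]
      by (cases "par F v") (auto simp: forest_iso_by_def)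
  qed
  then show ?thesis
    using b by (simp add: forest_iso_by_def bij_betw_inv_into)
qed

lemma forest_iso_by_comp:
  assumes "forest_iso_by f F G" "forest_iso_by g G H"
  shows "forest_iso_by (g \<circ> f) F H"
  using assms
  by (auto simp: forest_iso_by_def option.map_comp bij_betw_trans dest: bij_betwE)

lemma forest_iso_refl: "wf_forest F \<Longrightarrow> forest_iso F F"
  by (auto simp: forest_iso_def forest_iso_by_def option.map_id0 intro!: exI[of _ id])

lemma forest_iso_sym: "forest_iso F G \<Longrightarrow> forest_iso G F"
  using forest_iso_by_inv by (auto simp: forest_iso_def)

lemma forest_iso_trans: "forest_iso F G \<Longrightarrow> forest_iso G H \<Longrightarrow> forest_iso F H"
  using forest_iso_by_comp unfolding forest_iso_def by blast

lemma leaves_iso: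
  assumes "forest_iso_by f F G" "wf_forest F" "wf_forest G"
  shows "bij_betw f (leaves F) (leaves G)"
proof -
  have b: "bij_betw f (verts F) (verts G)" using assms by (simp add: forest_iso_by_def)
  have *: "f v \<in> leaves G \<longleftrightarrow> v \<in> leaves F" if v: "v \<in> verts F" for v
  proof -
    have "children G (f v) = f ` children F v"
    proof safe
      fix w assume "w \<in> children G (f v)"
      then have w: "(f v, w) \<in> child_rel G" by (simp add: children_def)
      then have "w \<in> verts G" using child_rel_verts assms(3) by blast
      then obtain x where "x \<in> verts F" "w = f x" using b by (auto simp: bij_betw_def)
      then show "w \<in> f ` children F v"
        using w forest_iso_by_child_rel[OF assms(1,2) v] by (auto simp: children_def)
    next
      fix x assume "x \<in> children F v"
      then show "f x \<in> children G (f v)"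
        using forest_iso_by_child_rel[OF assms(1,2) v] child_rel_verts[OF assms(2)]
        by (auto simp: children_def)
    qed
    then show ?thesis using v b by (auto simp: leaves_def bij_betw_def)
  qed
  have "f ` leaves F = leaves G"
  proof (intro equalityI subsetI)
    fix w assume w: "w \<in> leaves G"
    then obtain v where "v \<in> verts F" "w = f v"
      using b by (auto simp: leaves_def bij_betw_def)
    then show "w \<in> f ` leaves F" using * w by auto
  qed (use * in \<open>auto simp: leaves_def\<close>)
  moreover have "inj_on f (leaves F)"
    using b by (auto simp: bij_betw_def leaves_def intro: inj_on_subset)
  ultimately show ?thesis by (simp add: bij_betw_def)
qed

lemma wf_forest_del_leaf:
  assumes "wf_forest F" "v \<in> leaves F"
  shows "wf_forest (del_vertex F v)"
proof -
  have "child_rel (del_vertex F v) \<subseteq> child_rel F"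
    by (auto simp: child_rel_def del_vertex_def)
  then show ?thesis
    using assms
    by (auto simp: wf_forest_def del_vertex_def leaves_def children_def child_rel_def
        intro: acyclic_subset)
qed

lemma forest_iso_del_leaf:
  assumes "forest_iso_by f F G" "wf_forest F" "wf_forest G" "v \<in> leaves F"
  shows "forest_iso (del_vertex F v) (del_vertex G (f v))"
proof -
  have "f v \<in> leaves G" using leaves_iso[OF assms(1-3)] assms(4) by (auto simp: bij_betw_def)
  moreover have "forest_iso_by f (del_vertex F v) (del_vertex G (f v))"
    using assms(1,4)
    by (auto simp: forest_iso_by_def del_vertex_def leaves_def
        intro!: bij_betw_DiffI dest: bij_betwE)
  ultimately show ?thesis
    using assms wf_forest_del_leaf by (auto simp: forest_iso_def)
qed

lemma inc_labellings_iso_le: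
  assumes "forest_iso_by f F G" "wf_forest F" "wf_forest G"
  shows "card (inc_labellings G) \<le> card (inc_labellings F)"
proof -
  let ?h = "\<lambda>l. restrict (l \<circ> f) (verts F)"
  have b: "bij_betw f (verts F) (verts G)" using assms by (simp add: forest_iso_by_def)
  have c: "card (verts F) = card (verts G)" using b by (rule bij_betw_same_card)
  have "inc_labellings F \<subseteq> verts F \<rightarrow>\<^sub>E {1..card (verts F)}"
    by (auto simp: inc_labellings_def PiE_def bij_betw_def)
  then have fin: "finite (inc_labellings F)"
    using assms(2) by (meson finite_PiE finite_atLeastAtMost finite_subset wf_forest_finite)
  have "?h ` inc_labellings G \<subseteq> inc_labellings F"
  proof safe
    fix l assume l: "l \<in> inc_labellings G"
    have "bij_betw (l \<circ> f) (verts F) {1..card (verts F)}"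
      using l b c by (auto simp: inc_labellings_def intro: bij_betw_trans)
    then have "bij_betw (?h l) (verts F) {1..card (verts F)}"
      by (simp cong: bij_betw_cong)
    moreover have "?h l u < ?h l v" if uv: "(u, v) \<in> child_rel F" for u v
    proof -
      have "u \<in> verts F" "v \<in> verts F" using uv child_rel_verts[OF assms(2)] by auto
      then show ?thesis
        using forest_iso_by_child_rel[OF assms(1,2)] uv l by (fastforce simp: inc_labellings_def)
    qed
    ultimately show "?h l \<in> inc_labellings F"
      unfolding inc_labellings_def by blast
  qed
  moreover have "inj_on ?h (inc_labellings G)"
  proof (rule inj_onI)
    fix l l' assume l: "l \<in> inc_labellings G" "l' \<in> inc_labellings G" and e: "?h l = ?h l'"
    have "l w = l' w" if w: "w \<in> verts G" for w
    proof -
      obtain v where "v \<in> verts F" "w = f v" using w b by (auto simp: bij_betw_def)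
      then show ?thesis using fun_cong[OF e, of v] by simp
    qed
    then show "l = l'"
      using l by (auto simp: inc_labellings_def intro: extensionalityI)
  qed
  ultimately show ?thesis using fin by (metis card_image card_mono)
qed

section \<open>The algebra\<close>

text \<open>Isomorphism classes of decorated rooted forests: the basis of the algebra. Disjoint union
  is written additively so that \<open>\<Rightarrow>\<^sub>0\<close> carries the corresponding monoid-algebra product.\<close>

quotient_type 'l forest = "'l dforest" / partial: forest_iso
proof (rule part_equivpI)
  show "\<exists>x :: 'l dforest. forest_iso x x" using forest_iso_refl[OF wf_forest_empty] by blast
  show "symp (forest_iso :: 'l dforest \<Rightarrow> _)" using forest_iso_sym by (auto simp: symp_def)
  show "transp (forest_iso :: 'l dforest \<Rightarrow> _)" using forest_iso_trans by (auto simp: transp_def)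
qed

instantiation forest :: (type) comm_monoid_add
begin

lift_definition zero_forest :: "'l forest" is empty_df
  by (rule forest_iso_refl[OF wf_forest_empty])

lift_definition plus_forest :: "'l forest \<Rightarrow> 'l forest \<Rightarrow> 'l forest" is disj_union
proof -
  fix F F' G G' :: "'l dforest"
  assume "forest_iso F F'" "forest_iso G G'"
  then obtain f g where fg: "forest_iso_by f F F'" "forest_iso_by g G G'"
    and wfs: "wf_forest F" "wf_forest F'" "wf_forest G" "wf_forest G'"
    by (auto simp: forest_iso_def)
  define h where "h v = (if even v then 2 * f (v div 2) else 2 * g (v div 2) + 1)" for v
  have h: "h (2 * n) = 2 * f n" "h (Suc (2 * n)) = Suc (2 * g n)" for n
    by (auto simp: h_def)
  have "forest_iso_by h (disj_union F G) (disj_union F' G')"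
  proof (rule forest_iso_byI)
    show "h ` verts (disj_union F G) = verts (disj_union F' G')"
    proof -
      have "verts F' = f ` verts F" "verts G' = g ` verts G"
        using fg by (auto simp: forest_iso_by_def bij_betw_def)
      then show ?thesis by (simp only: disj_union_simps h image_Un image_image)
    qed
    show "inj_on h (verts (disj_union F G))"
    proof -
      have "inj_on f (verts F)" "inj_on g (verts G)"
        using fg by (auto simp: forest_iso_by_def bij_betw_def)
      then show ?thesis
        unfolding disj_union_simps
        by (intro inj_onI; elim UnE imageE)
          (simp_all add: h inj_on_eq_iff Suc_double_not_eq_double double_not_eq_Suc_double)
    qed
    show "par (disj_union F' G') (h v) = map_option h (par (disj_union F G) v) \<and>
        lab (disj_union F' G') (h v) = lab (disj_union F G) v"
      if "v \<in> verts (disj_union F G)" for v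
      using that fg unfolding disj_union_simps
      by (elim UnE imageE)
        (simp_all add: forest_iso_by_def disj_union_simps h option.map_comp comp_def)
  qed
  then show "forest_iso (disj_union F G) (disj_union F' G')"
    using wfs by (auto simp: forest_iso_def wf_forest_disj_union)
qed

instance
proof
  fix x y z :: "'l forest"
  show "x + y + z = x + (y + z)"
  proof (transfer, goal_cases)
    case (1 F G H)
    define h where "h v = (if odd v then 4 * (v div 2) + 3
      else if odd (v div 2) then 4 * (v div 4) + 1 else 2 * (v div 4))" for v :: nat
    have h: "h (Suc (2 * n)) = Suc (2 * Suc (2 * n))" "h (2 * Suc (2 * n)) = Suc (2 * (2 * n))"
      "h (2 * (2 * n)) = 2 * n" for n
      by (auto simp: h_def)
    let ?A = "disj_union (disj_union F G) H" and ?B = "disj_union F (disj_union G H)"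
    have "forest_iso_by h ?A ?B"
    proof (rule forest_iso_byI)
      show "h ` verts ?A = verts ?B"
        by (simp only: disj_union_simps h image_Un image_image Un_assoc)
      show "inj_on h (verts ?A)"
        unfolding disj_union_simps image_Un image_image
        by (intro inj_onI; elim UnE imageE; hypsubst; simp only: h; presburger)
      show "par ?B (h v) = map_option h (par ?A v) \<and> lab ?B (h v) = lab ?A v"
        if "v \<in> verts ?A" for v
        using that unfolding disj_union_simps image_Un image_image
        by (elim UnE imageE) (simp_all only: disj_union_simps h option.map_comp comp_def)
    qed
    then show ?case using 1 by (auto simp: forest_iso_def wf_forest_disj_union)
  qed
  show "x + y = y + x"
  proof (transfer, goal_cases)
    case (1 F G)
    define h where "h v = (if even v then v + 1 else v - 1)" for v :: nat
    have h: "h (2 * n) = Suc (2 * n)" "h (Suc (2 * n)) = 2 * n" for n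
      by (auto simp: h_def)
    let ?A = "disj_union F G" and ?B = "disj_union G F"
    have "forest_iso_by h ?A ?B"
    proof (rule forest_iso_byI)
      show "h ` verts ?A = verts ?B"
        by (simp only: disj_union_simps h image_Un image_image Un_commute)
      show "inj_on h (verts ?A)"
        by (rule inj_on_inverseI[where g = h]) (auto simp: disj_union_simps h)
      show "par ?B (h v) = map_option h (par ?A v) \<and> lab ?B (h v) = lab ?A v"
        if "v \<in> verts ?A" for v
        using that by (auto simp: disj_union_simps h option.map_comp comp_def)
    qed
    then show ?case using 1 by (auto simp: forest_iso_def wf_forest_disj_union)
  qed
  show "0 + x = x"
  proof (transfer, goal_cases)
    case (1 F)
    have "forest_iso_by (\<lambda>v. v div 2) (disj_union empty_df F) F"
    proof (rule forest_iso_byI)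
      show "(\<lambda>v. v div 2) ` verts (disj_union empty_df F) = verts F"
        by (simp add: disj_union_simps empty_df_def image_image)
      show "inj_on (\<lambda>v. v div 2) (verts (disj_union empty_df F))"
        by (auto simp: disj_union_simps empty_df_def inj_on_def)
      show "par F (v div 2) = map_option (\<lambda>v. v div 2) (par (disj_union empty_df F) v) \<and>
          lab F (v div 2) = lab (disj_union empty_df F) v"
        if "v \<in> verts (disj_union empty_df F)" for v
        using that
        by (auto simp: disj_union_simps empty_df_def option.map_comp comp_def option.map_ident)
    qed
    then show ?case using 1 by (auto simp: forest_iso_def wf_forest_disj_union wf_forest_empty)
  qed
qed

end

lift_definition dot :: "'l forest" is dot_df
  by (rule forest_iso_refl[OF wf_forest_dot])

lift_definition deg :: "'l forest \<Rightarrow> nat" is "\<lambda>F. card (verts F)"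
  by (auto simp: forest_iso_def forest_iso_by_def dest: bij_betw_same_card)

definition basis_deg :: "nat \<Rightarrow> 'l forest set" where
  "basis_deg n = {x. deg x = n}"

lift_definition eta :: "'l forest \<Rightarrow> nat" is "\<lambda>F. card (inc_labellings F)"
proof -
  fix F G :: "'l dforest"
  assume a: "forest_iso F G"
  show "card (inc_labellings F) = card (inc_labellings G)"
    using a forest_iso_sym[OF a] inc_labellings_iso_le
    unfolding forest_iso_def by (metis le_antisym)
qed

type_synonym 'l ckh = "'l forest \<Rightarrow>\<^sub>0 real"

definition smul :: "real \<Rightarrow> ('a \<Rightarrow>\<^sub>0 real) \<Rightarrow> ('a \<Rightarrow>\<^sub>0 real)" where
  "smul c p = Poly_Mapping.map ((*) c) p"

definition lin_ext :: "('a \<Rightarrow> ('b \<Rightarrow>\<^sub>0 real)) \<Rightarrow> ('a \<Rightarrow>\<^sub>0 real) \<Rightarrow> ('b \<Rightarrow>\<^sub>0 real)" where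
  "lin_ext f p = (\<Sum>x\<in>Poly_Mapping.keys p. smul (Poly_Mapping.lookup p x) (f x))"

abbreviation bas :: "'a \<Rightarrow> ('a \<Rightarrow>\<^sub>0 real)" where
  "bas x \<equiv> Poly_Mapping.single x 1"

text \<open>\<open>Delta1 x\<close> is the component of the coproduct of \<open>x\<close> in degree \<open>(1, deg x - 1)\<close>; the tensor
  square is the free vector space on pairs of basis elements.\<close>

lift_definition Delta1 :: "'l forest \<Rightarrow> ('l forest \<times> 'l forest) \<Rightarrow>\<^sub>0 real" is
  "\<lambda>F. \<Sum>v\<in>leaves F. bas (dot, abs_forest (del_vertex F v))"
proof -
  fix F G :: "'l dforest"
  assume "forest_iso F G"
  then obtain f where f: "forest_iso_by f F G" and wfs: "wf_forest F" "wf_forest G"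
    by (auto simp: forest_iso_def)
  have "abs_forest (del_vertex F v) = abs_forest (del_vertex G (f v))" if "v \<in> leaves F" for v
    using forest_iso_del_leaf[OF f wfs that] Quotient_forest by (metis Quotient_rel_abs)
  then have "(\<Sum>v\<in>leaves F. bas (dot :: 'l forest, abs_forest (del_vertex F v))) =
      (\<Sum>v\<in>leaves F. bas (dot, abs_forest (del_vertex G (f v))))"
    by simp
  also have "\<dots> = (\<Sum>v\<in>leaves G. bas (dot, abs_forest (del_vertex G v)))"
    by (rule sum.reindex_bij_betw[OF leaves_iso[OF f wfs]])
  finally show "(\<Sum>v\<in>leaves F. bas (dot :: 'l forest, abs_forest (del_vertex F v))) =
      (\<Sum>v\<in>leaves G. bas (dot, abs_forest (del_vertex G v)))" .
qed

text \<open>\<open>Delta r x\<close> is the component in degree \<open>(1, \<dots>, 1, deg x - r)\<close> of the iterated coproduct;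
  the \<open>(r + 1)\<close>-st tensor power is the free vector space on lists of length \<open>r + 1\<close>.\<close>

primrec Delta :: "nat \<Rightarrow> 'l forest \<Rightarrow> ('l forest list) \<Rightarrow>\<^sub>0 real" where
  "Delta 0 x = bas [x]"
| "Delta (Suc r) x = lin_ext (\<lambda>(a, b). lin_ext (\<lambda>ys. bas (a # ys)) (Delta r b)) (Delta1 x)"

definition mult_tensor :: "(('l forest list) \<Rightarrow>\<^sub>0 real) \<Rightarrow> 'l ckh" where
  "mult_tensor = lin_ext (\<lambda>xs. prod_list (map bas xs))"

definition mDelta :: "nat \<Rightarrow> 'l ckh \<Rightarrow> 'l ckh" where
  "mDelta r p = mult_tensor (lin_ext (Delta r) p)"

definition T2R :: "nat \<Rightarrow> 'l ckh \<Rightarrow> 'l ckh" where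
  "T2R m p = smul (1 / real m) (mDelta 1 p)"

definition BinT2R :: "nat \<Rightarrow> real \<Rightarrow> 'l ckh \<Rightarrow> 'l ckh" where
  "BinT2R m q p = (\<Sum>r\<le>m. smul (1 / fact r * (1 - q) ^ r * q ^ (m - r)) (mDelta r p))"

definition Khat :: "('l ckh \<Rightarrow> 'l ckh) \<Rightarrow> 'l forest \<Rightarrow> 'l forest \<Rightarrow> real" where
  "Khat T x y = real (eta y) / real (eta x) * Poly_Mapping.lookup (T (bas x)) y"


section \<open>Rooted trees and rooted subtrees\<close>

definition rooted_tree :: "'l dforest \<Rightarrow> bool" where
  "rooted_tree T \<longleftrightarrow> wf_forest T \<and> (\<exists>!v. v \<in> verts T \<and> par T v = None)"

definition root :: "'l dforest \<Rightarrow> nat" where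
  "root T = (THE v. v \<in> verts T \<and> par T v = None)"

definition connected_set :: "'l dforest \<Rightarrow> nat set \<Rightarrow> bool" where
  "connected_set T S \<longleftrightarrow>
     (\<forall>u\<in>S. \<forall>v\<in>S. (u, v) \<in> ((child_rel T \<union> (child_rel T)\<inverse>) \<inter> S \<times> S)\<^sup>*)"

definition rooted_subtrees :: "'l dforest \<Rightarrow> nat set set" where
  "rooted_subtrees T = {S. S \<subseteq> verts T \<and> root T \<in> S \<and> connected_set T S}"

definition add_dots :: "'l dforest \<Rightarrow> nat set \<Rightarrow> 'l forest" where
  "add_dots T0 S =
     sum_list (replicate (card (verts T0) - card S) dot) + abs_forest (T0\<lparr>verts := S\<rparr>)"


section \<open>The employee-firing chain\<close>

text \<open>A configuration within one step is a pair \<open>(S, occ)\<close>: the set \<open>S\<close> of remaining positions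
  and the map \<open>occ\<close> from positions to employees. At the start of each step an employee is named
  after the position held, so that \<open>occ = id\<close>; employees have to be tracked because one who is
  due to be fired may have been promoted by an earlier cascade of the same step. The guard
  \<open>\<not> wf_forest T\<close> only serves to make the recursion terminate for arbitrary \<open>T\<close>.\<close>

type_synonym config = "nat set \<times> (nat \<Rightarrow> nat)"

function cascade :: "'l dforest \<Rightarrow> (nat \<Rightarrow> nat) \<Rightarrow> nat \<Rightarrow> config pmf" where
  "cascade T occ u =
     (if \<not> wf_forest T \<or> children T u = {} then return_pmf (verts T - {u}, occ)
      else bind_pmf (pmf_of_set (strict_desc T u)) (\<lambda>w. cascade T (occ(u := occ w)) w))"
  by pat_completeness auto
termination
proof (relation "Wellfounded.measure (\<lambda>(T, _, u). card (strict_desc T u))", goal_cases)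
  case (2 T occ u w)
  then have wfT: "wf_forest T" and ch: "children T u \<noteq> {}" by auto
  have sub: "strict_desc T v \<subseteq> verts T" for v
    using trancl_subset_Sigma[OF child_rel_verts[OF wfT]] by (auto simp: strict_desc_def)
  have fin: "finite (strict_desc T v)" for v
    using finite_subset[OF sub wf_forest_finite[OF wfT]] .
  have "strict_desc T u \<noteq> {}" using ch by (auto simp: children_def strict_desc_def)
  then have w: "(u, w) \<in> (child_rel T)\<^sup>+"
    using 2 fin by (auto simp: set_pmf_of_set strict_desc_def)
  then have "strict_desc T w \<subseteq> strict_desc T u" by (auto simp: strict_desc_def intro: trancl_trans)
  moreover have "w \<in> strict_desc T u" "w \<notin> strict_desc T w"
    using w wfT by (auto simp: strict_desc_def wf_forest_def acyclic_def)
  ultimately have "strict_desc T w \<subset> strict_desc T u" by blast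
  then show ?case using fin by (auto intro: psubset_card_mono)
qed simp

declare cascade.simps [simp del]

definition fire :: "'l dforest \<Rightarrow> nat \<Rightarrow> config \<Rightarrow> config pmf" where
  "fire T0 e = (\<lambda>(S, occ).
     if card S = 1 then return_pmf (S, occ)
     else cascade (T0\<lparr>verts := S\<rparr>) occ (THE v. v \<in> S \<and> occ v = e))"

primrec fire_list :: "'l dforest \<Rightarrow> nat list \<Rightarrow> config \<Rightarrow> config pmf" where
  "fire_list T0 [] c = return_pmf c"
| "fire_list T0 (e # es) c = bind_pmf (fire T0 e c) (fire_list T0 es)"

definition single_model :: "'l dforest \<Rightarrow> nat set \<Rightarrow> nat set pmf" where
  "single_model T0 S =
     do {
       b \<leftarrow> bernoulli_pmf (real (card S) / real (card (verts T0)));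
       if b then do {
         e \<leftarrow> pmf_of_set S;
         map_pmf fst (fire T0 e (S, id))
       } else return_pmf S
     }"

definition binomial_model :: "'l dforest \<Rightarrow> real \<Rightarrow> nat set \<Rightarrow> nat set pmf" where
  "binomial_model T0 q S =
     do {
       fired \<leftarrow> Pi_pmf S False (\<lambda>_. bernoulli_pmf (1 - q));
       es \<leftarrow> pmf_of_set (permutations_of_set {e \<in> S. fired e});
       map_pmf fst (fire_list T0 es (S, id))
     }"

end

theory Submission
  imports Defs
begin

text \<open>
  The promotion cascade started at a uniformly random employee is a hook walk: a telescoping
  product along the path from the root to a leaf \<open>v\<close> shows that it deletes \<open>v\<close> with probability
  \<open>w (T - v) / (n * w T)\<close>, where \<open>w T\<close> is the inverse of the product of the hook lengths of \<open>T\<close>.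
  Summing over \<open>v\<close> gives the recursion satisfied by the number of increasing labellings, hence
  the hook length formula \<open>eta (dots k + T) = (k + n)! * w T\<close>. So the Doob transform by \<open>eta\<close> turns
  removing a leaf into firing a uniform employee, and the same holds for \<open>r\<close> successive removals
  because, after a cascade, a uniform remaining employee again sits at a uniform remaining position.
  Isolated dots split off: \<open>BinT2R (m + 1) (dot + x) = dot * BinT2R m x\<close>, by
  \<open>mDelta (r + 1) (dot + x) = dot * (mDelta (r + 1) x + (r + 1) * mDelta r x)\<close>.
\<close>

section \<open>Linear algebra\<close>

text \<open>The obstacle is a mismatch of sizes: both operators act on \<open>n0\<close> vertices,
  while a model in state \<open>S\<close> sees only the \<open>card S\<close> positions still
  occupied. Removing an isolated dot and multiplying by \<open>dot\<close> changes nothing. So the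
  surplus dots supply the probability of no change in the single model, and in the binomial model
  they disappear because q + (1 - q) = 1. The boss is covered by the same mechanism: a one-vertex
  tree is itself a dot, so removing it acts as the identity, just as no firing occurs there. The
  factor 1 / r! in \<open>BinT2R\<close> meets the n! / (n - r)! produced by the hook weights, and
  together they form the binomial coefficient. The identities are proved in the algebra, as sums
  over subtrees; distinct labels enter at the end, when coefficients are read off.\<close>

lemma lookup_smul [simp]: "Poly_Mapping.lookup (smul c p) k = c * Poly_Mapping.lookup p k"
  by (simp add: smul_def Poly_Mapping.map.rep_eq when_def)

lemma smul_zero_left [simp]: "smul 0 p = 0"
  and smul_zero_right [simp]: "smul c 0 = 0"
  and smul_one [simp]: "smul 1 p = p"
  and smul_smul: "smul c (smul d p) = smul (c * d) p"
  and smul_single: "smul c (Poly_Mapping.single x d) = Poly_Mapping.single x (c * d)"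
  and smul_add_left: "smul (c + d) p = smul c p + smul d p"
  and smul_add_right: "smul c (p + q) = smul c p + smul c q"
  by (auto intro!: poly_mapping_eqI simp: lookup_add lookup_single when_def algebra_simps)

lemma smul_sum: "smul c (sum f A) = (\<Sum>x\<in>A. smul c (f x))"
  by (auto intro!: poly_mapping_eqI simp: lookup_sum sum_distrib_left)

lemma single_sum: "Poly_Mapping.single x (sum f A) = (\<Sum>a\<in>A. Poly_Mapping.single x (f a))"
  by (induction A rule: infinite_finite_induct) (auto simp: single_add)

lemma sum_single_lookup:
  "(\<Sum>k\<in>Poly_Mapping.keys p. Poly_Mapping.single k (Poly_Mapping.lookup p k)) = p"
  by (rule poly_mapping_eqI) (simp add: lookup_sum lookup_single when_def in_keys_iff)

text \<open>Writing a scalar as a multiple of the unit lets it move through products by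
  commutativity alone.\<close>

lemma smul_eq_times:
  fixes p :: "'a::comm_monoid_add \<Rightarrow>\<^sub>0 real"
  shows "smul c p = Poly_Mapping.single 0 c * p"
proof -
  have "Poly_Mapping.single 0 c * p =
      Poly_Mapping.single 0 c * (\<Sum>k\<in>Poly_Mapping.keys p. Poly_Mapping.single k (Poly_Mapping.lookup p k))"
    by (simp add: sum_single_lookup)
  also have "\<dots> = (\<Sum>k\<in>Poly_Mapping.keys p. smul c (Poly_Mapping.single k (Poly_Mapping.lookup p k)))"
    by (simp add: sum_distrib_left mult_single smul_single)
  also have "\<dots> = smul c p"
    by (simp add: sum_single_lookup flip: smul_sum)
  finally show ?thesis by simp
qed

lemma times_smul:
  fixes p q :: "'a::comm_monoid_add \<Rightarrow>\<^sub>0 real"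
  shows "p * smul c q = smul c (p * q)"
  by (simp add: smul_eq_times mult_ac)

text \<open>The set of keys shrinks under cancellation; a fixed finite superset allows linear
  extensions of different elements to be compared term by term.\<close>

lemma lin_ext_superset:
  assumes "finite A" "Poly_Mapping.keys p \<subseteq> A"
  shows "lin_ext f p = (\<Sum>x\<in>A. smul (Poly_Mapping.lookup p x) (f x))"
  unfolding lin_ext_def
  by (rule sum.mono_neutral_left) (use assms in \<open>auto simp: in_keys_iff\<close>)

lemma lin_ext_bas [simp]: "lin_ext f (bas x) = f x"
  by (simp add: lin_ext_def)

lemma lin_ext_zero [simp]: "lin_ext f 0 = 0"
  by (simp add: lin_ext_def)

lemma lin_ext_add: "lin_ext f (p + q) = lin_ext f p + lin_ext f q"
proof -
  let ?A = "Poly_Mapping.keys p \<union> Poly_Mapping.keys q"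
  have "Poly_Mapping.keys (p + q) \<subseteq> ?A" by (rule keys_add)
  then show ?thesis
    by (simp add: lin_ext_superset[where A = ?A] lookup_add smul_add_left sum.distrib)
qed

lemma lin_ext_sum: "lin_ext f (sum g A) = (\<Sum>x\<in>A. lin_ext f (g x))"
  by (induction A rule: infinite_finite_induct) (auto simp: lin_ext_add)

lemma lin_ext_smul: "lin_ext f (smul c p) = smul c (lin_ext f p)"
proof -
  have "Poly_Mapping.keys (smul c p) \<subseteq> Poly_Mapping.keys p"
    by (auto simp: in_keys_iff)
  then have "lin_ext f (smul c p) =
      (\<Sum>x\<in>Poly_Mapping.keys p. smul (Poly_Mapping.lookup (smul c p) x) (f x))"
    by (intro lin_ext_superset) auto
  then show ?thesis
    by (simp add: lin_ext_def smul_smul smul_sum)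
qed

section \<open>Sums over the leaves of a forest\<close>

lemma abs_forest_eqI: "forest_iso F G \<Longrightarrow> abs_forest F = abs_forest G"
  using Quotient_forest by (metis Quotient_rel_abs)

lemma forest_cases:
  obtains F where "wf_forest F" "x = abs_forest F"
  by (metis Quotient_forest Quotient_def forest_iso_def)

text \<open>One operator for all sums over removed leaves. The codomain is arbitrary because the
  same sum yields the coproduct, the iterated removal operators and the recursion for
  \<open>eta\<close>. It respects isomorphism because an isomorphism matches leaves and the forests
  left after their deletion.\<close>

lift_definition leaf_sum :: "'l forest \<Rightarrow> ('l forest \<Rightarrow> 'b::comm_monoid_add) \<Rightarrow> 'b" is
  "\<lambda>F g. \<Sum>v\<in>leaves F. g (abs_forest (del_vertex F v))"
proof (rule ext)
  fix F G :: "'l dforest" and g :: "'l forest \<Rightarrow> 'b"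
  assume "forest_iso F G"
  then obtain f where f: "forest_iso_by f F G" and wfs: "wf_forest F" "wf_forest G"
    by (auto simp: forest_iso_def)
  have "(\<Sum>v\<in>leaves F. g (abs_forest (del_vertex F v))) =
      (\<Sum>v\<in>leaves F. g (abs_forest (del_vertex G (f v))))"
    using abs_forest_eqI[OF forest_iso_del_leaf[OF f wfs]] by simp
  also have "\<dots> = (\<Sum>v\<in>leaves G. g (abs_forest (del_vertex G v)))"
    by (rule sum.reindex_bij_betw[OF leaves_iso[OF f wfs]])
  finally show "(\<Sum>v\<in>leaves F. g (abs_forest (del_vertex F v))) =
      (\<Sum>v\<in>leaves G. g (abs_forest (del_vertex G v)))" .
qed

lemma leaf_sum_abs:
  "wf_forest F \<Longrightarrow> leaf_sum (abs_forest F) g = (\<Sum>v\<in>leaves F. g (abs_forest (del_vertex F v)))"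
  by (simp add: leaf_sum.abs_eq forest_iso_refl)

lemma leaf_sum_distrib: "leaf_sum x (\<lambda>z. f z + g z) = leaf_sum x f + leaf_sum x g"
  by (cases x rule: forest_cases) (simp add: leaf_sum_abs sum.distrib)

lemma leaf_sum_mult_left:
  fixes c :: "'b::semiring_0"
  shows "leaf_sum x (\<lambda>z. c * f z) = c * leaf_sum x f"
  by (cases x rule: forest_cases) (simp add: leaf_sum_abs sum_distrib_left)

lemma leaf_sum_smul: "leaf_sum x (\<lambda>z. smul c (f z)) = smul c (leaf_sum x f)"
  by (cases x rule: forest_cases) (simp add: leaf_sum_abs smul_sum)

lemma lin_ext_leaf_sum: "lin_ext f (leaf_sum x g) = leaf_sum x (\<lambda>z. lin_ext f (g z))"
  by (cases x rule: forest_cases) (simp add: leaf_sum_abs lin_ext_sum)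

lemma deg_abs: "wf_forest F \<Longrightarrow> deg (abs_forest F) = card (verts F)"
  by (simp add: deg.abs_eq forest_iso_refl)

lemma leaf_sum_cong_deg:
  assumes "\<And>z. Suc (deg z) = deg x \<Longrightarrow> f z = g z"
  shows "leaf_sum x f = leaf_sum x g"
proof (cases x rule: forest_cases)
  case (1 F)
  have "Suc (deg (abs_forest (del_vertex F v))) = deg x" if "v \<in> leaves F" for v
  proof -
    have "v \<in> verts F" using that by (simp add: leaves_def)
    then show ?thesis
      using 1 wf_forest_finite[OF 1(1)] wf_forest_del_leaf[OF 1(1) that] card_gt_0_iff[of "verts F"]
      by (auto simp: deg_abs del_vertex_def card_Diff_singleton)
  qed
  then show ?thesis using 1 assms by (simp add: leaf_sum_abs)
qed

lemma leaf_sum_zero [simp]: "leaf_sum x (\<lambda>_. 0) = 0"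
  by (cases x rule: forest_cases) (simp add: leaf_sum_abs)

lemma leaf_sum_deg_0: "deg x = 0 \<Longrightarrow> leaf_sum x g = 0"
  \<comment> \<open>In degree 0 the hypothesis of the congruence is vacuous, since no successor is
    0.\<close>
  by (subst leaf_sum_cong_deg[where g = "\<lambda>_. 0"]) auto

section \<open>Leaf removal as a derivation for disjoint union\<close>

lemma child_rel_disj_union:
  "child_rel (disj_union F G) =
     map_prod (\<lambda>n. 2 * n) (\<lambda>n. 2 * n) ` child_rel F \<union>
     map_prod (\<lambda>n. Suc (2 * n)) (\<lambda>n. Suc (2 * n)) ` child_rel G"
  by (auto simp: child_rel_def disj_union_simps image_iff)

lemma leaves_disj_union:
  "leaves (disj_union F G) = (\<lambda>n. 2 * n) ` leaves F \<union> (\<lambda>n. Suc (2 * n)) ` leaves G"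
proof -
  have "children (disj_union F G) (2 * n) = (\<lambda>n. 2 * n) ` children F n"
    "children (disj_union F G) (Suc (2 * n)) = (\<lambda>n. Suc (2 * n)) ` children G n" for n
    unfolding children_def child_rel_disj_union by (auto simp: image_iff; presburger)+
  then show ?thesis
    unfolding leaves_def disj_union_simps by auto
qed

lemma del_vertex_disj_union:
  "del_vertex (disj_union F G) (2 * v) = disj_union (del_vertex F v) G"
  "del_vertex (disj_union F G) (Suc (2 * v)) = disj_union F (del_vertex G v)"
  by (auto simp: del_vertex_def disj_union_def; presburger)+

lemma abs_forest_disj_union:
  "wf_forest F \<Longrightarrow> wf_forest G \<Longrightarrow> abs_forest (disj_union F G) = abs_forest F + abs_forest G"
  by (simp add: plus_forest.abs_eq forest_iso_refl)

text \<open>The Leibniz rule: a leaf of a disjoint union is a leaf of exactly one of the two parts,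
  and its deletion leaves the other part untouched.\<close>

lemma leaf_sum_plus:
  "leaf_sum (x + y) g = leaf_sum x (\<lambda>z. g (z + y)) + leaf_sum y (\<lambda>z. g (x + z))"
proof (cases x rule: forest_cases)
  case F: (1 F)
  show ?thesis
  proof (cases y rule: forest_cases)
    case G: (1 G)
    have fin: "finite (leaves F)" "finite (leaves G)"
      using F G by (auto simp: leaves_def wf_forest_finite)
    have disj: "(\<lambda>n. 2 * n) ` leaves F \<inter> (\<lambda>n. Suc (2 * n)) ` leaves G = {}"
      by auto presburger
    have "leaf_sum (x + y) g =
        (\<Sum>v\<in>leaves (disj_union F G). g (abs_forest (del_vertex (disj_union F G) v)))"
      using F G by (simp add: leaf_sum_abs wf_forest_disj_union flip: abs_forest_disj_union)
    also have "\<dots> = (\<Sum>v\<in>leaves F. g (abs_forest (disj_union (del_vertex F v) G))) +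
        (\<Sum>v\<in>leaves G. g (abs_forest (disj_union F (del_vertex G v))))"
      unfolding leaves_disj_union
      by (subst sum.union_disjoint)
        (use fin disj in \<open>auto simp: sum.reindex inj_on_def del_vertex_disj_union\<close>)
    also have "\<dots> = (\<Sum>v\<in>leaves F. g (abs_forest (del_vertex F v) + y)) +
        (\<Sum>v\<in>leaves G. g (x + abs_forest (del_vertex G v)))"
      using F G by (simp add: abs_forest_disj_union wf_forest_del_leaf)
    finally show ?thesis using F G by (simp add: leaf_sum_abs)
  qed
qed

lemma leaf_sum_dot: "leaf_sum (dot :: 'a forest) g = g 0"
proof -
  have dot: "dot = abs_forest (dot_df :: 'a dforest)" by (simp add: dot_def)
  have l: "leaves (dot_df :: 'a dforest) = {0}" by (auto simp: leaves_def dot_df_def children_def child_rel_def)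
  have "forest_iso (del_vertex dot_df 0) (empty_df :: 'a dforest)"
    using wf_forest_del_leaf[OF wf_forest_dot, of 0] l wf_forest_empty
    by (auto simp: forest_iso_def forest_iso_by_def del_vertex_def dot_df_def empty_df_def)
  then have "abs_forest (del_vertex dot_df 0) = (0 :: 'a forest)"
    by (simp add: abs_forest_eqI zero_forest_def)
  then show ?thesis by (simp add: dot leaf_sum_abs wf_forest_dot l)
qed

lemma deg_zero [simp]: "deg 0 = 0"
  by transfer (simp add: empty_df_def)

lemma deg_dot [simp]: "deg dot = 1"
  by transfer (simp add: dot_df_def)

lemma deg_plus: "deg (x + y) = deg x + deg y"
proof (cases x rule: forest_cases)
  case F: (1 F)
  show ?thesis
  proof (cases y rule: forest_cases)
    case G: (1 G)
    have "(\<lambda>n. 2 * n) ` verts F \<inter> (\<lambda>n. Suc (2 * n)) ` verts G = {}"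
      by auto presburger
    then have "card (verts (disj_union F G)) = card (verts F) + card (verts G)"
      unfolding disj_union_simps using F G
      by (subst card_Un_disjoint) (simp_all add: wf_forest_finite card_image inj_on_def)
    then show ?thesis
      using F G by (simp add: deg_abs wf_forest_disj_union flip: abs_forest_disj_union)
  qed
qed

abbreviation (input) dots :: "nat \<Rightarrow> 'l forest" where
  "dots k \<equiv> sum_list (replicate k dot)"

lemma deg_dots [simp]: "deg (dots k) = k"
  by (induction k) (auto simp: deg_plus)

lemma dots_add: "dots (j + k) = dots j + dots k"
  by (simp add: replicate_add)

text \<open>Each of the \<open>k\<close> dots contributes the same term. For \<open>k = 0\<close>
  the truncated \<open>k - 1\<close> is harmless, because its term carries the factor 0.\<close>

lemma leaf_sum_dots_plus:
  fixes g :: "'l forest \<Rightarrow> real"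
  shows "leaf_sum (dots k + x) g = real k * g (dots (k - 1) + x) + leaf_sum x (\<lambda>z. g (dots k + z))"
proof (induction k arbitrary: g)
  case (Suc k)
  have "leaf_sum (dots (Suc k) + x) g = leaf_sum (dot + (dots k + x)) g"
    by (simp add: add_ac)
  also have "\<dots> = g (dots k + x) + leaf_sum (dots k + x) (\<lambda>z. g (dot + z))"
    by (simp add: leaf_sum_plus leaf_sum_dot)
  also have "\<dots> = g (dots k + x) + (real k * g (dot + (dots (k - 1) + x)) +
      leaf_sum x (\<lambda>z. g (dot + (dots k + z))))"
    by (simp add: Suc)
  also have "real k * g (dot + (dots (k - 1) + x)) = real k * g (dots k + x)"
    by (cases k) (auto simp: add_ac)
  finally show ?case by (simp add: algebra_simps)
qed simp

section \<open>Leaf removal operators\<close>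

lemma Delta1_eq_leaf_sum: "Delta1 x = leaf_sum x (\<lambda>z. bas (dot, z))"
  by transfer simp

lemma Delta_Suc:
  "Delta (Suc r) x = leaf_sum x (\<lambda>z. lin_ext (\<lambda>ys. bas (dot # ys)) (Delta r z))"
  by (simp add: Delta1_eq_leaf_sum lin_ext_leaf_sum)

lemma mult_tensor_Cons:
  "mult_tensor (lin_ext (\<lambda>ys. bas (a # ys)) p) = bas a * mult_tensor p"
proof -
  have "mult_tensor (lin_ext (\<lambda>ys. bas (a # ys)) p) =
     (\<Sum>x\<in>Poly_Mapping.keys p. smul (Poly_Mapping.lookup p x) (bas a * prod_list (map bas x)))"
    unfolding mult_tensor_def by (subst (2) lin_ext_def) (simp add: lin_ext_sum lin_ext_smul)
  then show ?thesis
    by (simp add: mult_tensor_def lin_ext_def sum_distrib_left times_smul)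
qed

lemma mDelta_0 [simp]: "mDelta 0 (bas x) = bas x"
  by (simp add: mDelta_def mult_tensor_def)

text \<open>The first removed leaf is multiplied back as a factor \<open>dot\<close>; this recursion
  replaces the tensor powers in everything that follows.\<close>

lemma mDelta_Suc:
  "mDelta (Suc r) (bas x) = bas dot * leaf_sum x (\<lambda>z. mDelta r (bas z))"
proof -
  have "mDelta (Suc r) (bas x) =
      leaf_sum x (\<lambda>z. mult_tensor (lin_ext (\<lambda>ys. bas (dot # ys)) (Delta r z)))"
    by (simp add: mDelta_def Delta_Suc mult_tensor_def lin_ext_leaf_sum del: Delta.simps)
  then show ?thesis
    by (simp add: mult_tensor_Cons leaf_sum_mult_left mDelta_def)
qed

lemma mDelta_eq_0: "deg x < r \<Longrightarrow> mDelta r (bas x) = 0"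
proof (induction r arbitrary: x)
  case (Suc r)
  have "leaf_sum x (\<lambda>z. mDelta r (bas z)) = leaf_sum x (\<lambda>_. 0)"
    by (rule leaf_sum_cong_deg) (use Suc in auto)
  then show ?case by (simp add: mDelta_Suc)
qed simp

text \<open>Among \<open>Suc r\<close> successive removals the extra dot is either never chosen, and
  survives as a factor, or chosen at one of \<open>Suc r\<close> moments, and then the
  multiplication puts it back while \<open>r\<close> removals act on \<open>x\<close>.\<close>

lemma mDelta_dot_plus:
  fixes x :: "'a forest"
  shows "mDelta (Suc r) (bas (dot + x)) =
     bas dot * (mDelta (Suc r) (bas x) + smul (real (Suc r)) (mDelta r (bas x)))"
proof (induction r arbitrary: x)
  case 0
  have "bas (dot + z) = bas dot * bas z" for z :: "'a forest"
    by (simp add: mult_single)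
  then show ?case
    by (simp add: mDelta_Suc leaf_sum_plus leaf_sum_dot leaf_sum_mult_left distrib_left add_ac)
next
  case (Suc r)
  have "mDelta (Suc (Suc r)) (bas (dot + x)) =
      bas dot * (mDelta (Suc r) (bas x) + leaf_sum x (\<lambda>z. mDelta (Suc r) (bas (dot + z))))"
    by (subst mDelta_Suc) (simp add: leaf_sum_plus leaf_sum_dot)
  also have "leaf_sum x (\<lambda>z. mDelta (Suc r) (bas (dot + z))) =
      mDelta (Suc (Suc r)) (bas x) + smul (real (Suc r)) (mDelta (Suc r) (bas x))"
    \<comment> \<open>\<open>mDelta_Suc\<close> is fixed at \<open>x\<close>, so that the sums over
      leaves fold up without unfolding the operators at the smaller forests.\<close>
    by (simp add: Suc leaf_sum_mult_left leaf_sum_distrib leaf_sum_smul distrib_left times_smul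
        mDelta_Suc[of _ x])
  also have "mDelta (Suc r) (bas x) + (mDelta (Suc (Suc r)) (bas x) +
        smul (real (Suc r)) (mDelta (Suc r) (bas x))) =
      mDelta (Suc (Suc r)) (bas x) + smul (real (Suc (Suc r))) (mDelta (Suc r) (bas x))"
    using smul_add_left[of 1 "real (Suc r)" "mDelta (Suc r) (bas x)"] by (simp add: add_ac)
  finally show ?case .
qed

text \<open>Removing one of the \<open>k\<close> dots and multiplying it back is the identity; these
  \<open>k\<close> copies become the event that nobody is fired in the single model.\<close>

lemma mDelta_1_dots_plus:
  "mDelta 1 (bas (dots k + x)) = bas (dots k) * (mDelta 1 (bas x) + smul (real k) (bas x))"
proof (induction k)
  case 0
  then show ?case by (simp add: single_one)
next
  case (Suc k)
  have "mDelta 1 (bas (dots (Suc k) + x)) =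
      bas dot * (mDelta 1 (bas (dots k + x)) + bas (dots k + x))"
    using mDelta_dot_plus[of 0 "dots k + x"] by (simp add: add_ac)
  also have "\<dots> = bas dot * (bas (dots k) *
      (mDelta 1 (bas x) + smul (real k) (bas x) + bas x))"
    unfolding Suc by (simp add: distrib_left mult_single)
  also have "\<dots> = bas (dots (Suc k)) * (mDelta 1 (bas x) + smul (real (Suc k)) (bas x))"
    by (simp add: smul_add_left mult_single add_ac flip: mult.assoc)
  finally show ?case .
qed

text \<open>The additional dot is kept with weight q or removed with weight 1 - q, with the same
  result. At the level of coefficients, \<open>c2\<close> and \<open>c1\<close> express these two
  cases, and their sum reproduces \<open>c m r\<close>.\<close>

lemma BinT2R_dot_plus:
  assumes "deg x = m"
  shows "BinT2R (Suc m) q (bas (dot + x)) = bas dot * BinT2R m q (bas x)"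
proof -
  define c where "c m r = 1 / fact r * (1 - q) ^ r * q ^ (m - r)" for m r
  have c0: "c (Suc m) 0 = q * c m 0" by (simp add: c_def)
  have c1: "c (Suc m) (Suc r) * real (Suc r) = (1 - q) * c m r" if "r \<le> m" for r
    using that by (simp add: c_def field_simps del: of_nat_Suc)
  \<comment> \<open>At \<open>r = m\<close> the truncated exponent would spoil this identity; the
    corresponding term vanishes by \<open>D\<close>, as \<open>x\<close> has only \<open>m\<close>
    vertices.\<close>
  have c2: "c (Suc m) (Suc r) = q * c m (Suc r)" if "r < m" for r
  proof -
    have "m - r = Suc (m - Suc r)" using that by simp
    then show ?thesis by (simp add: c_def)
  qed
  let ?D = "\<lambda>r. mDelta r (bas x)"
  have D: "?D (Suc m) = 0" using assms by (simp add: mDelta_eq_0)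
  have "BinT2R (Suc m) q (bas (dot + x)) =
      smul (c (Suc m) 0) (bas (dot + x)) +
      (\<Sum>r\<le>m. smul (c (Suc m) (Suc r)) (mDelta (Suc r) (bas (dot + x))))"
    unfolding BinT2R_def c_def[symmetric] by (subst sum.atMost_Suc_shift) simp
  also have "(\<Sum>r\<le>m. smul (c (Suc m) (Suc r)) (mDelta (Suc r) (bas (dot + x)))) =
      bas dot * ((\<Sum>r\<le>m. smul (c (Suc m) (Suc r)) (?D (Suc r))) +
        (\<Sum>r\<le>m. smul (c (Suc m) (Suc r) * real (Suc r)) (?D r)))"
    by (simp add: mDelta_dot_plus smul_add_right smul_smul times_smul sum_distrib_left sum.distrib
        distrib_left del: of_nat_Suc flip: times_smul)
  also have "(\<Sum>r\<le>m. smul (c (Suc m) (Suc r)) (?D (Suc r))) =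
      (\<Sum>r<m. smul (q * c m (Suc r)) (?D (Suc r)))"
    by (simp add: D c2 flip: lessThan_Suc_atMost)
  also have "(\<Sum>r\<le>m. smul (c (Suc m) (Suc r) * real (Suc r)) (?D r)) =
      (\<Sum>r\<le>m. smul ((1 - q) * c m r) (?D r))"
    by (rule sum.cong) (use c1 in auto)
  also have "smul (c (Suc m) 0) (bas (dot + x)) = bas dot * smul (q * c m 0) (?D 0)"
    by (simp add: c0 mult_single times_smul)
  also have "bas dot * smul (q * c m 0) (?D 0) + bas dot *
      ((\<Sum>r<m. smul (q * c m (Suc r)) (?D (Suc r))) + (\<Sum>r\<le>m. smul ((1 - q) * c m r) (?D r))) =
    bas dot * ((smul (q * c m 0) (?D 0) + (\<Sum>r<m. smul (q * c m (Suc r)) (?D (Suc r)))) +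
       (\<Sum>r\<le>m. smul ((1 - q) * c m r) (?D r)))"
    by (simp only: distrib_left add.assoc)
  also have "smul (q * c m 0) (?D 0) + (\<Sum>r<m. smul (q * c m (Suc r)) (?D (Suc r))) =
      (\<Sum>r\<le>m. smul (q * c m r) (?D r))"
    by (simp only: sum.lessThan_Suc_shift flip: lessThan_Suc_atMost)
  also have "\<dots> + (\<Sum>r\<le>m. smul ((1 - q) * c m r) (?D r)) = (\<Sum>r\<le>m. smul (c m r) (?D r))"
    by (simp add: algebra_simps flip: sum.distrib smul_add_left)
  finally show ?thesis by (simp add: BinT2R_def c_def)
qed

lemma BinT2R_dots_plus:
  "BinT2R (k + deg x) q (bas (dots k + x)) = bas (dots k) * BinT2R (deg x) q (bas x)"
proof (induction k)
  case (Suc k)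
  have "BinT2R (Suc k + deg x) q (bas (dots (Suc k) + x)) =
      bas dot * BinT2R (k + deg x) q (bas (dots k + x))"
    using BinT2R_dot_plus[of "dots k + x" "k + deg x" q] by (simp add: deg_plus add_ac)
  then show ?case
    by (simp add: Suc mult_single flip: mult.assoc)
qed (simp add: single_one)

section \<open>Increasing labellings\<close>

lemma finite_inc_labellings: "finite (verts F) \<Longrightarrow> finite (inc_labellings F)"
  by (rule finite_subset[OF _ finite_PiE[of "verts F" "\<lambda>_. {1..card (verts F)}"]])
    (auto simp: inc_labellings_def PiE_def bij_betw_def)

text \<open>The vertex with the largest number has no children, since a child would need a larger
  one; deleting it leaves an increasing labelling of the rest, and conversely any leaf may receive
  the largest number.\<close>

lemma inc_labellings_eq_UN:
  assumes wf: "wf_forest F" and ne: "verts F \<noteq> {}"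
  shows "inc_labellings F =
    (\<Union>v\<in>leaves F. (\<lambda>g. g(v := card (verts F))) ` inc_labellings (del_vertex F v))"
proof -
  define m where "m = card (verts F)"
  have fin: "finite (verts F)" using wf by (rule wf_forest_finite)
  have m: "m > 0" using ne fin by (simp add: m_def card_gt_0_iff)
  have card: "card (verts F - {v}) = m - 1" if "v \<in> verts F" for v
    using that fin by (simp add: m_def)
  have ivl: "{1..m} - {m} = {1..m - 1}" using m by auto
  have cr: "child_rel (del_vertex F v) = {(u, w) \<in> child_rel F. w \<noteq> v}" for v
    by (auto simp: child_rel_def del_vertex_def)
  show ?thesis
  proof (intro equalityI subsetI)
    fix f assume "f \<in> inc_labellings F"
    then have f: "f \<in> extensional (verts F)" "bij_betw f (verts F) {1..m}"
      "\<And>u w. (u, w) \<in> child_rel F \<Longrightarrow> f u < f w"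
      by (auto simp: inc_labellings_def m_def)
    then obtain v where v: "v \<in> verts F" "f v = m"
      using m by (metis atLeastAtMost_iff bij_betwE bij_betw_imp_surj_on imageE less_eq_Suc_le
          One_nat_def order_refl)
    have leaf: "v \<in> leaves F"
    proof -
      have False if "(v, w) \<in> child_rel F" for w
      proof -
        have "f w \<in> {1..m}" using that f(2) by (auto simp: child_rel_def bij_betw_def)
        then show False using f(3)[OF that] v by simp
      qed
      then show ?thesis using v by (auto simp: leaves_def children_def)
    qed
    have nv: "u \<noteq> v" if "(u, w) \<in> child_rel F" for u w
      using leaf that by (auto simp: leaves_def children_def)
    \<comment> \<open>Labellings are extensional, so the value at the deleted vertex has to be
      reset.\<close>
    let ?g = "f(v := undefined)"
    have "bij_betw f (verts F - {v}) ({1..m} - {m})"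
      using f(2) v m by (intro bij_betw_DiffI) auto
    then have "bij_betw ?g (verts F - {v}) {1..m - 1}"
      unfolding ivl by (subst bij_betw_cong[where g = f]) auto
    moreover have "?g \<in> extensional (verts F - {v})" using f(1) by (auto simp: extensional_def)
    moreover have "\<forall>(u, w)\<in>child_rel (del_vertex F v). ?g u < ?g w"
      using f(3) nv by (auto simp: cr)
    moreover have "verts (del_vertex F v) = verts F - {v}" by (simp add: del_vertex_def)
    ultimately have "?g \<in> inc_labellings (del_vertex F v)"
      using card[OF v(1)] by (simp add: inc_labellings_def)
    moreover have "f = ?g(v := m)" using v by auto
    ultimately show "f \<in> (\<Union>v\<in>leaves F. (\<lambda>g. g(v := card (verts F))) ` inc_labellings (del_vertex F v))"
      using leaf unfolding m_def by blast
  next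
    fix f assume "f \<in> (\<Union>v\<in>leaves F. (\<lambda>g. g(v := card (verts F))) ` inc_labellings (del_vertex F v))"
    then obtain v g where leaf: "v \<in> leaves F" and fg: "f = g(v := m)"
      and g: "g \<in> inc_labellings (del_vertex F v)"
      unfolding m_def by blast
    have v: "v \<in> verts F" using leaf by (simp add: leaves_def)
    have g': "g \<in> extensional (verts F - {v})" "bij_betw g (verts F - {v}) {1..m - 1}"
      "\<And>u w. (u, w) \<in> child_rel F \<Longrightarrow> w \<noteq> v \<Longrightarrow> g u < g w"
      using g card[OF v] by (auto simp: inc_labellings_def cr) (auto simp: del_vertex_def)
    have nv: "u \<noteq> v" if "(u, w) \<in> child_rel F" for u w
      using leaf that by (auto simp: leaves_def children_def)
    have "bij_betw f (verts F - {v}) {1..m - 1}"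
      using g'(2) unfolding fg by (subst bij_betw_cong[where g = g]) auto
    moreover have "bij_betw f {v} {m}" by (simp add: fg)
    ultimately have "bij_betw f ((verts F - {v}) \<union> {v}) ({1..m - 1} \<union> {m})"
      by (rule bij_betw_combine) (use m in auto)
    moreover have "(verts F - {v}) \<union> {v} = verts F" using v by auto
    moreover have "{1..m - 1} \<union> {m} = {1..m}" using m by auto
    ultimately have b: "bij_betw f (verts F) {1..m}" by simp
    have "f u < f w" if uw: "(u, w) \<in> child_rel F" for u w
    proof (cases "w = v")
      case True
      have "u \<in> verts F - {v}" using uw nv child_rel_verts[OF wf] by auto
      then have "g u \<in> {1..m - 1}" using g'(2) by (auto dest: bij_betwE)
      then show ?thesis using True nv[OF uw] m by (auto simp: fg)
    next
      case False
      then show ?thesis using g'(3)[OF uw] nv[OF uw] by (simp add: fg)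
    qed
    moreover have "f \<in> extensional (verts F)" using g'(1) v by (auto simp: fg extensional_def)
    ultimately show "f \<in> inc_labellings F"
      using b unfolding inc_labellings_def m_def by blast
  qed
qed

lemma card_inc_labellings:
  assumes wf: "wf_forest F" and ne: "verts F \<noteq> {}"
  shows "card (inc_labellings F) = (\<Sum>v\<in>leaves F. card (inc_labellings (del_vertex F v)))"
proof -
  let ?m = "card (verts F)"
  let ?A = "\<lambda>v. (\<lambda>g. g(v := ?m)) ` inc_labellings (del_vertex F v)"
  have fin: "finite (verts F)" using wf by (rule wf_forest_finite)
  \<comment> \<open>A common labelling would give the largest number to both vertices, against
    injectivity.\<close>
  have "?A v \<inter> ?A w = {}" if "v \<in> leaves F" "w \<in> leaves F" "v \<noteq> w" for v w
  proof (rule ccontr)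
    assume "?A v \<inter> ?A w \<noteq> {}"
    then obtain f where f: "f \<in> ?A v" "f \<in> ?A w" by blast
    have "f v = ?m" using f(1) by auto
    moreover have "f w = ?m" using f(2) by auto
    moreover have "f \<in> inc_labellings F"
      using f that unfolding inc_labellings_eq_UN[OF assms] by blast
    ultimately show False
      using that by (auto simp: inc_labellings_def leaves_def bij_betw_def inj_on_def)
  qed
  then have eq: "card (inc_labellings F) = (\<Sum>v\<in>leaves F. card (?A v))"
    unfolding inc_labellings_eq_UN[OF assms] using fin
    by (intro card_UN_disjoint)
      (auto simp: leaves_def del_vertex_def intro!: finite_imageI finite_inc_labellings)
  \<comment> \<open>No information is lost by overwriting the value at \<open>v\<close>: it was
    \<open>undefined\<close> in every labelling of the smaller forest.\<close>
  have "card (?A v) = card (inc_labellings (del_vertex F v))" for v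
  proof (rule card_image, rule inj_onI, rule ext)
    fix g h x
    assume "g \<in> inc_labellings (del_vertex F v)" "h \<in> inc_labellings (del_vertex F v)"
      and eq: "g(v := ?m) = h(v := ?m)"
    then have "g v = undefined" "h v = undefined"
      by (auto simp: inc_labellings_def del_vertex_def extensional_def)
    then show "g x = h x" using fun_cong[OF eq, of x] by (auto split: if_splits)
  qed
  with eq show ?thesis by simp
qed

lemma eta_leaf_sum:
  assumes "deg x > 0"
  shows "real (eta x) = leaf_sum x (\<lambda>z. real (eta z))"
proof (cases x rule: forest_cases)
  case (1 F)
  have eta: "eta (abs_forest G) = card (inc_labellings G)" if "wf_forest G" for G :: "'a dforest"
    using that by (simp add: eta.abs_eq forest_iso_refl)
  have "verts F \<noteq> {}" using assms 1 by (auto simp: deg_abs)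
  then show ?thesis
    using 1 by (simp add: eta leaf_sum_abs wf_forest_del_leaf card_inc_labellings)
qed

lemma eta_zero: "eta 0 = 1"
proof -
  have "inc_labellings (empty_df :: 'a dforest) = {\<lambda>_. undefined}"
    by (auto simp: inc_labellings_def empty_df_def child_rel_def bij_betw_def)
  then show ?thesis by transfer simp
qed

section \<open>Hook lengths and the promotion cascade\<close>

definition hook :: "'l dforest \<Rightarrow> nat \<Rightarrow> nat" where
  "hook T u = Suc (card (strict_desc T u))"

definition inv_hooks :: "'l dforest \<Rightarrow> real" where
  "inv_hooks T = 1 / (\<Prod>u\<in>verts T. real (hook T u))"

lemma inv_hooks_pos: "inv_hooks T > 0"
  by (simp add: inv_hooks_def hook_def prod_pos)

lemma strict_desc_subset: "wf_forest T \<Longrightarrow> strict_desc T u \<subseteq> verts T"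
  using trancl_subset_Sigma[OF child_rel_verts[of T]] by (auto simp: strict_desc_def)

lemma finite_strict_desc: "wf_forest T \<Longrightarrow> finite (strict_desc T u)"
  using finite_subset[OF strict_desc_subset wf_forest_finite] .

lemma strict_desc_empty_iff: "strict_desc T u = {} \<longleftrightarrow> children T u = {}"
  by (auto simp: children_def strict_desc_def dest: tranclD)

text \<open>A leaf is never an inner vertex of a descending path, so its deletion cuts no path
  between other vertices.\<close>

lemma strict_desc_del_leaf:
  assumes "v \<in> leaves T"
  shows "strict_desc (del_vertex T v) u = strict_desc T u - {v}"
proof -
  have cr: "child_rel (del_vertex T v) = {(u, w) \<in> child_rel T. w \<noteq> v}"
    by (auto simp: child_rel_def del_vertex_def)
  have "w \<noteq> v \<Longrightarrow> (u, w) \<in> (child_rel (del_vertex T v))\<^sup>+" if "(u, w) \<in> (child_rel T)\<^sup>+" for w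
    using that
  proof (induction rule: trancl_induct)
    case (base w)
    then show ?case by (auto simp: cr)
  next
    case (step x w)
    have "x \<noteq> v" using step(2) assms by (auto simp: leaves_def children_def)
    then show ?case using step by (auto simp: cr intro: trancl_into_trancl)
  qed
  moreover have "(u, w) \<in> (child_rel T)\<^sup>+" if "(u, w) \<in> (child_rel (del_vertex T v))\<^sup>+" for w
    using that by (rule trancl_mono) (auto simp: cr)
  moreover have "(u, v) \<notin> (child_rel (del_vertex T v))\<^sup>+"
    by (auto simp: cr dest: tranclD2)
  ultimately show ?thesis by (auto simp: strict_desc_def)
qed

text \<open>The hook length of \<open>v\<close> is 1, and exactly its proper ancestors lose one
  descendant: their hook length drops from \<open>hook T x\<close> to
  \<open>card (strict_desc T x)\<close>.\<close>

lemma inv_hooks_del_leaf: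
  assumes wf: "wf_forest T" and v: "v \<in> leaves T"
  shows "inv_hooks (del_vertex T v) = inv_hooks T *
    (\<Prod>x\<in>{x. (x, v) \<in> (child_rel T)\<^sup>+}. real (hook T x) / real (card (strict_desc T x)))"
proof -
  let ?A = "{x. (x, v) \<in> (child_rel T)\<^sup>+}" and ?V = "verts T - {v}"
  have fin: "finite (verts T)" using wf by (rule wf_forest_finite)
  have vT: "v \<in> verts T" using v by (simp add: leaves_def)
  have A: "?A \<subseteq> ?V"
    using trancl_subset_Sigma[OF child_rel_verts[OF wf]] wf by (auto simp: wf_forest_def acyclic_def)
  have hv: "hook T v = 1"
    using v by (simp add: hook_def leaves_def flip: strict_desc_empty_iff)
  have h: "hook (del_vertex T v) x = (if x \<in> ?A then card (strict_desc T x) else hook T x)" for x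
  proof (cases "x \<in> ?A")
    case True
    then have "v \<in> strict_desc T x" by (simp add: strict_desc_def)
    then have "card (strict_desc T x) > 0"
      using finite_strict_desc[OF wf] by (auto simp: card_gt_0_iff)
    then show ?thesis
      using True \<open>v \<in> strict_desc T x\<close> by (simp add: hook_def strict_desc_del_leaf[OF v])
  next
    case False
    then have "v \<notin> strict_desc T x" by (simp add: strict_desc_def)
    then show ?thesis using False by (simp add: hook_def strict_desc_del_leaf[OF v])
  qed
  have split: "(\<Prod>x\<in>?V. f x) = (\<Prod>x\<in>?A. f x) * (\<Prod>x\<in>?V - ?A. f x)" for f :: "nat \<Rightarrow> real"
    using prod.subset_diff[OF A, of f] fin by (simp add: mult.commute)
  have T: "(\<Prod>x\<in>verts T. real (hook T x)) = (\<Prod>x\<in>?V. real (hook T x))"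
    using prod.remove[OF fin vT, of "\<lambda>x. real (hook T x)"] hv by simp
  have "(\<Prod>x\<in>verts (del_vertex T v). real (hook (del_vertex T v) x)) =
      (\<Prod>x\<in>?A. real (card (strict_desc T x))) * (\<Prod>x\<in>?V - ?A. real (hook T x))"
    by (simp add: del_vertex_def[of T v] split h[unfolded del_vertex_def])
  moreover have "(\<Prod>x\<in>?A. real (hook T x)) \<noteq> 0"
    using finite_subset[OF A] fin by (auto simp: hook_def)
  ultimately show ?thesis
    unfolding inv_hooks_def T split by (simp add: prod_dividef)
qed

text \<open>The set of positions left after a cascade from \<open>u\<close>; it does not depend on who sits where.\<close>

definition vacate :: "'l dforest \<Rightarrow> nat \<Rightarrow> nat set pmf" where
  "vacate T u = map_pmf fst (cascade T id u)"

lemma map_fst_cascade_cong: "map_pmf fst (cascade T occ u) = map_pmf fst (cascade T occ' u)"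
proof (induction T occ u arbitrary: occ' rule: cascade.induct)
  case (1 T occ u)
  show ?case
  proof (cases "\<not> wf_forest T \<or> children T u = {}")
    case True
    then show ?thesis by (simp add: cascade.simps[of T _ u])
  next
    case False
    then show ?thesis
      unfolding cascade.simps[of T _ u] if_not_P[OF False] map_bind_pmf
      by (intro bind_pmf_cong refl "1.IH")
  qed
qed

lemma map_fst_cascade: "map_pmf fst (cascade T occ u) = vacate T u"
  unfolding vacate_def by (rule map_fst_cascade_cong)

lemma vacate_leaf: "children T u = {} \<Longrightarrow> vacate T u = return_pmf (verts T - {u})"
  by (simp add: vacate_def cascade.simps[of T _ u])

lemma vacate_rec:
  assumes "wf_forest T" "children T u \<noteq> {}"
  shows "vacate T u = bind_pmf (pmf_of_set (strict_desc T u)) (vacate T)"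
  using assms by (simp add: vacate_def[of T u] cascade.simps[of T _ u] map_bind_pmf map_fst_cascade)

text \<open>The position \<open>u\<close> counts as vacant throughout: the value of
  \<open>occ\<close> there belongs to the fired employee and is disregarded. Every promotion moves
  the vacancy downwards and keeps the set of seated employees, until the vacancy reaches a
  leaf.\<close>

lemma cascade_support:
  assumes "(S', occ') \<in> set_pmf (cascade T occ u)" "wf_forest T" "u \<in> verts T"
    and "inj_on occ (verts T - {u})"
  shows "\<exists>l\<in>leaves T. (u, l) \<in> (child_rel T)\<^sup>* \<and> S' = verts T - {l} \<and>
           inj_on occ' S' \<and> occ' ` S' = occ ` (verts T - {u})"
  using assms
proof (induction T occ u rule: cascade.induct)
  case (1 T occ u)
  show ?case
  proof (cases "children T u = {}")
    case True
    then show ?thesis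
      using "1.prems" by (intro bexI[of _ u]) (auto simp: cascade.simps[of T _ u] leaves_def)
  next
    case False
    have ne: "strict_desc T u \<noteq> {}" using False by (simp add: strict_desc_empty_iff)
    have supp: "set_pmf (pmf_of_set (strict_desc T u)) = strict_desc T u"
      using ne finite_strict_desc[OF "1.prems"(2)] by simp
    obtain w where w: "w \<in> strict_desc T u" "(S', occ') \<in> set_pmf (cascade T (occ(u := occ w)) w)"
      using "1.prems"(1,2) False by (auto simp: cascade.simps[of T _ u] supp)
    have wT: "w \<in> verts T" using w strict_desc_subset[OF "1.prems"(2)] by auto
    have uw: "(u, w) \<in> (child_rel T)\<^sup>+" using w by (simp add: strict_desc_def)
    have "u \<noteq> w" using uw "1.prems"(2) by (auto simp: wf_forest_def acyclic_def)
    then have eq: "(occ(u := occ w)) ` (verts T - {w}) = occ ` (verts T - {u})"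
      using wT "1.prems"(3) by (auto simp: image_iff)
    \<comment> \<open>Injectivity after the promotion follows by counting: the same image arises
      from a domain of the same finite size.\<close>
    have "card (verts T - {w}) = card (verts T - {u})"
      using wT "1.prems"(2,3) by (simp add: wf_forest_finite)
    then have inj: "inj_on (occ(u := occ w)) (verts T - {w})"
      using "1.prems"(2,4) eq by (metis wf_forest_finite card_image eq_card_imp_inj_on finite_Diff)
    have "\<not> (\<not> wf_forest T \<or> children T u = {})" "w \<in> set_pmf (pmf_of_set (strict_desc T u))"
      using "1.prems"(2) False supp w(1) by auto
    from "1.IH"[OF this w(2) "1.prems"(2) wT inj] obtain l where "l \<in> leaves T" "(w, l) \<in> (child_rel T)\<^sup>*" "S' = verts T - {l}"
      "inj_on occ' S'" "occ' ` S' = occ ` (verts T - {u})"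
      unfolding eq by blast
    moreover have "(u, l) \<in> (child_rel T)\<^sup>*"
      using uw \<open>(w, l) \<in> (child_rel T)\<^sup>*\<close> by (meson rtrancl_trans trancl_into_rtrancl)
    ultimately show ?thesis by blast
  qed
qed

lemma set_vacate:
  assumes "wf_forest T" "u \<in> verts T"
  shows "set_pmf (vacate T u) \<subseteq> {verts T - {l} | l. l \<in> leaves T \<and> (u, l) \<in> (child_rel T)\<^sup>*}"
  using cascade_support[OF _ assms, of _ _ id] by (fastforce simp: vacate_def)

lemma par_unique: "(x, v) \<in> child_rel T \<Longrightarrow> (y, v) \<in> child_rel T \<Longrightarrow> x = y"
  by (simp add: child_rel_def)

text \<open>Summed over the path from \<open>u\<close> down to \<open>v\<close>, the exit probabilities gain a factor
  \<open>hook / (hook - 1)\<close> whenever the path is extended upwards by one vertex.\<close>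

lemma sum_exit_path:
  assumes wf: "wf_forest T" and v: "v \<in> leaves T" and uv: "(u, v) \<in> (child_rel T)\<^sup>*"
  defines "R \<equiv> child_rel T" and "p \<equiv> \<lambda>x. pmf (vacate T x) (verts T - {v})"
  shows "(\<Sum>x\<in>{x. (u, x) \<in> R\<^sup>* \<and> (x, v) \<in> R\<^sup>*}. p x) =
    (\<Prod>x\<in>{x. (u, x) \<in> R\<^sup>* \<and> (x, v) \<in> R\<^sup>+}. real (hook T x) / real (card (strict_desc T x)))"
  using uv[folded R_def]
proof (induction rule: converse_rtrancl_induct)
  have vT: "v \<in> verts T" and ch: "children T v = {}" using v by (auto simp: leaves_def)
  have acyc: "(x, x) \<notin> R\<^sup>+" for x using wf by (auto simp: wf_forest_def acyclic_def R_def)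
  have RT: "(x, y) \<in> R\<^sup>+ \<Longrightarrow> x \<in> verts T \<and> y \<in> verts T" for x y
    using trancl_subset_Sigma[OF child_rel_verts[OF wf]] by (auto simp: R_def)
  have fin: "finite (verts T)" using wf by (rule wf_forest_finite)
  {
    case base
    have 1: "{x. (v, x) \<in> R\<^sup>* \<and> (x, v) \<in> R\<^sup>*} = {v}"
      using acyc by (auto dest: rtranclD intro: trancl_trans)
    have 2: "{x. (v, x) \<in> R\<^sup>* \<and> (x, v) \<in> R\<^sup>+} = {}"
      using acyc by (auto intro: rtrancl_trancl_trancl)
    show ?case unfolding 1 2 by (simp add: p_def vacate_leaf[OF ch])
  next
    case (step u c)
    let ?P = "{x. (c, x) \<in> R\<^sup>* \<and> (x, v) \<in> R\<^sup>*}" and ?Q = "{x. (c, x) \<in> R\<^sup>* \<and> (x, v) \<in> R\<^sup>+}"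
    \<comment> \<open>Because parents are unique, the ancestors of \<open>v\<close> form a single
      path; those properly below \<open>u\<close> therefore lie at or below its child
      \<open>c\<close>.\<close>
    have cmp: "(c, x) \<in> R\<^sup>*" if "(u, x) \<in> R\<^sup>+" "(x, v) \<in> R\<^sup>*" for x
      using that(2,1)
    proof (induction rule: converse_rtrancl_induct)
      case base
      show ?case by fact
    next
      case (step x y)
      have "(c, y) \<in> R\<^sup>*" using step by (meson trancl_into_trancl)
      \<comment> \<open>If \<open>y\<close> were \<open>c\<close>, then \<open>x\<close> would be
        its parent \<open>u\<close>, although \<open>x\<close> lies properly below
        \<open>u\<close>.\<close>
      moreover have "y \<noteq> c"
        using step \<open>(u, c) \<in> R\<close> acyc par_unique[of x c T u] unfolding R_def by blast
      ultimately obtain z where "(c, z) \<in> R\<^sup>*" "(z, y) \<in> R" by (metis rtranclE)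
      then show ?case using step(1) par_unique[of x y T z] unfolding R_def by blast
    qed
    have uc: "(u, x) \<in> R\<^sup>+" if "(c, x) \<in> R\<^sup>*" for x
      using that step(1) by (meson rtrancl_into_trancl2)
    have uv: "(u, v) \<in> R\<^sup>+" using step uc by blast
    have eqP: "{x. (u, x) \<in> R\<^sup>* \<and> (x, v) \<in> R\<^sup>*} = insert u ?P"
      using cmp uc uv by (auto dest: rtranclD intro: trancl_into_rtrancl)
    have eqQ: "{x. (u, x) \<in> R\<^sup>* \<and> (x, v) \<in> R\<^sup>+} = insert u ?Q"
      using cmp uc uv by (auto dest: rtranclD intro: trancl_into_rtrancl)
    have notin: "u \<notin> ?P" "u \<notin> ?Q" using uc acyc by blast+
    have finP: "finite ?P" by (rule finite_subset[OF _ fin]) (use RT uc in blast)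
    have finQ: "finite ?Q" by (rule finite_subset[OF _ fin]) (use RT uc in blast)
    have sub: "?P \<subseteq> strict_desc T u" using uc by (auto simp: strict_desc_def R_def)
    \<comment> \<open>A cascade from \<open>x\<close> ends at a leaf reachable from
      \<open>x\<close>, so off the path it cannot delete \<open>v\<close>.\<close>
    have zero: "p x = 0" if "x \<in> strict_desc T u - ?P" for x
    proof -
      have x: "x \<in> verts T" using that strict_desc_subset[OF wf] by blast
      have "(x, v) \<notin> R\<^sup>*" using that cmp by (auto simp: strict_desc_def R_def)
      then have "verts T - {v} \<notin> set_pmf (vacate T x)"
        using set_vacate[OF wf x] vT by (auto simp: R_def leaves_def)
      then show ?thesis by (simp add: p_def set_pmf_iff)
    qed
    have chu: "children T u \<noteq> {}" using step(1) by (auto simp: children_def R_def)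
    have ne: "strict_desc T u \<noteq> {}" using chu by (simp add: strict_desc_empty_iff)
    have pu: "p u = (\<Sum>x\<in>?P. p x) / real (card (strict_desc T u))"
    proof -
      have "p u = (\<Sum>x\<in>strict_desc T u. p x) / real (card (strict_desc T u))"
        unfolding p_def vacate_rec[OF wf chu]
        by (rule pmf_bind_pmf_of_set[OF ne finite_strict_desc[OF wf]])
      also have "(\<Sum>x\<in>strict_desc T u. p x) = (\<Sum>x\<in>?P. p x)"
        using sub zero by (intro sum.mono_neutral_right finite_strict_desc[OF wf]) auto
      finally show ?thesis .
    qed
    have "card (strict_desc T u) > 0" using ne finite_strict_desc[OF wf] by (simp add: card_gt_0_iff)
    \<comment> \<open>With d the number of strict descendants of \<open>u\<close>, the uniform
      choice makes \<open>p u\<close> equal to 1/d of the sum, and \<open>hook T u\<close> is d +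
      1.\<close>
    then have "p u + (\<Sum>x\<in>?P. p x) =
        real (hook T u) / real (card (strict_desc T u)) * (\<Sum>x\<in>?P. p x)"
      unfolding pu by (simp add: hook_def field_simps)
    then show ?case
      unfolding eqP eqQ using finP finQ notin by (simp add: step.IH)
  }
qed

lemma rooted_tree_root:
  assumes "rooted_tree T"
  shows "root T \<in> verts T" "par T (root T) = None"
    and "v \<in> verts T \<Longrightarrow> par T v = None \<Longrightarrow> v = root T"
proof -
  have *: "\<exists>!v. v \<in> verts T \<and> par T v = None" using assms by (simp add: rooted_tree_def)
  from theI'[OF *] show "root T \<in> verts T" "par T (root T) = None" by (auto simp: root_def)
  then show "v \<in> verts T \<Longrightarrow> par T v = None \<Longrightarrow> v = root T" using * by blast
qed

lemma rooted_tree_reachable: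
  assumes "rooted_tree T" "v \<in> verts T"
  shows "(root T, v) \<in> (child_rel T)\<^sup>*"
proof -
  have wf: "wf_forest T" using assms by (simp add: rooted_tree_def)
  show ?thesis using assms(2)
  proof (induction v rule: wf_induct_rule[OF wf_child_rel[OF wf]])
    case (1 v)
    show ?case
    proof (cases "par T v")
      case None
      then show ?thesis using rooted_tree_root(3)[OF assms(1) 1(2)] by simp
    next
      case (Some u)
      then have "(u, v) \<in> child_rel T" "u \<in> verts T"
        using 1 wf_forest_parD[OF wf] by (auto simp: child_rel_def)
      then show ?thesis using 1 by (meson rtrancl.rtrancl_into_rtrancl)
    qed
  qed
qed

section \<open>The hook walk from a uniform starting vertex\<close>

definition hook_walk :: "'l dforest \<Rightarrow> nat set pmf" where
  "hook_walk T = bind_pmf (pmf_of_set (verts T)) (vacate T)"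

text \<open>Only starting vertices on the path from the root to \<open>v\<close> can lead to the
  deletion of \<open>v\<close>. Their exit probabilities sum to the product of hook ratios over the
  proper ancestors of \<open>v\<close>, which is the quotient of the two weights.\<close>

lemma pmf_hook_walk:
  assumes T: "rooted_tree T" and v: "v \<in> leaves T"
  shows "inv_hooks (del_vertex T v) =
    real (card (verts T)) * inv_hooks T * pmf (hook_walk T) (verts T - {v})"
proof -
  let ?R = "child_rel T" and ?p = "\<lambda>x. pmf (vacate T x) (verts T - {v})"
  have wf: "wf_forest T" using T by (simp add: rooted_tree_def)
  have fin: "finite (verts T)" using wf by (rule wf_forest_finite)
  have vT: "v \<in> verts T" using v by (simp add: leaves_def)
  have RT: "(x, y) \<in> ?R\<^sup>+ \<Longrightarrow> x \<in> verts T" for x y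
    using trancl_subset_Sigma[OF child_rel_verts[OF wf]] by auto
  have RT': "(x, v) \<in> ?R\<^sup>* \<Longrightarrow> x \<in> verts T" for x
    using RT vT by (auto dest: rtranclD)
  have "pmf (hook_walk T) (verts T - {v}) = (\<Sum>x\<in>verts T. ?p x) / real (card (verts T))"
    unfolding hook_walk_def by (rule pmf_bind_pmf_of_set) (use fin vT in auto)
  also have "(\<Sum>x\<in>verts T. ?p x) = (\<Sum>x\<in>{x. (root T, x) \<in> ?R\<^sup>* \<and> (x, v) \<in> ?R\<^sup>*}. ?p x)"
  proof (rule sum.mono_neutral_right[OF fin])
    show "{x. (root T, x) \<in> ?R\<^sup>* \<and> (x, v) \<in> ?R\<^sup>*} \<subseteq> verts T" using RT' by blast
    show "\<forall>x\<in>verts T - {x. (root T, x) \<in> ?R\<^sup>* \<and> (x, v) \<in> ?R\<^sup>*}. ?p x = 0"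
    proof
      fix x assume x: "x \<in> verts T - {x. (root T, x) \<in> ?R\<^sup>* \<and> (x, v) \<in> ?R\<^sup>*}"
      then have "(x, v) \<notin> ?R\<^sup>*" using rooted_tree_reachable[OF T] by blast
      then have "verts T - {v} \<notin> set_pmf (vacate T x)"
        using set_vacate[OF wf, of x] x vT by (auto simp: leaves_def)
      then show "?p x = 0" by (simp add: set_pmf_iff)
    qed
  qed
  also have "\<dots> = (\<Prod>x\<in>{x. (root T, x) \<in> ?R\<^sup>* \<and> (x, v) \<in> ?R\<^sup>+}.
      real (hook T x) / real (card (strict_desc T x)))"
    by (rule sum_exit_path[OF wf v rooted_tree_reachable[OF T vT]])
  also have "{x. (root T, x) \<in> ?R\<^sup>* \<and> (x, v) \<in> ?R\<^sup>+} = {x. (x, v) \<in> ?R\<^sup>+}"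
    using rooted_tree_reachable[OF T] RT by blast
  finally show ?thesis
    using inv_hooks_del_leaf[OF wf v] fin vT by auto
qed

lemma set_hook_walk:
  assumes "rooted_tree T"
  shows "set_pmf (hook_walk T) \<subseteq> (\<lambda>l. verts T - {l}) ` leaves T"
proof -
  have wf: "wf_forest T" using assms by (simp add: rooted_tree_def)
  have "set_pmf (pmf_of_set (verts T)) = verts T"
    using wf_forest_finite[OF wf] rooted_tree_root(1)[OF assms] by (intro set_pmf_of_set) auto
  then have "\<exists>u\<in>verts T. S \<in> set_pmf (vacate T u)" if "S \<in> set_pmf (hook_walk T)" for S
    using that by (auto simp: hook_walk_def)
  then show ?thesis using set_vacate[OF wf] by blast
qed

lemma inj_on_remove_leaf: "inj_on (\<lambda>l. verts T - {l}) (leaves T)"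
  by (auto simp: inj_on_def leaves_def)

text \<open>This is total probability 1 for the hook walk, which always deletes exactly one
  leaf.\<close>

lemma sum_inv_hooks_del_leaf:
  assumes "rooted_tree T"
  shows "(\<Sum>v\<in>leaves T. inv_hooks (del_vertex T v)) = real (card (verts T)) * inv_hooks T"
proof -
  have "finite (leaves T)"
    using assms by (auto simp: rooted_tree_def leaves_def wf_forest_finite)
  then have "(\<Sum>v\<in>leaves T. pmf (hook_walk T) (verts T - {v})) = 1"
    using sum_pmf_eq_1[OF _ set_hook_walk[OF assms]]
    by (simp add: sum.reindex[OF inj_on_remove_leaf])
  then show ?thesis
    by (simp add: pmf_hook_walk[OF assms] flip: sum_distrib_left)
qed

section \<open>Random permutations of random subsets\<close>

abbreviation distinct_lists :: "nat \<Rightarrow> 'a set \<Rightarrow> 'a list set" where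
  "distinct_lists r E \<equiv> {es. length es = r \<and> distinct es \<and> set es \<subseteq> E}"

lemma finite_distinct_lists: "finite E \<Longrightarrow> finite (distinct_lists r E)"
  by (rule finite_subset[OF _ finite_lists_length_eq[of E r]]) auto

lemma real_card_distinct_lists:
  assumes "finite E" "r \<le> card E"
  shows "real (card (distinct_lists r E)) = fact (card E) / fact (card E - r)"
proof -
  have "\<Prod>{card E - r + 1..card E} = fact (card E) div fact (card E - r)"
    by (rule fact_div_fact[symmetric]) simp
  then show ?thesis
    using card_lists_distinct_length_eq[OF assms]
    by (simp add: real_of_nat_div fact_dvd del: of_nat_prod)
qed

lemma distinct_lists_nonempty:
  assumes "finite E" "r \<le> card E"
  shows "distinct_lists r E \<noteq> {}"
proof
  assume "distinct_lists r E = {}"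
  then have "card (distinct_lists r E) = 0" by (simp only: card.empty)
  then show False using real_card_distinct_lists[OF assms] by simp
qed

text \<open>A uniform sequence without repetition can be drawn entry by entry, because every first
  entry admits the same number of continuations.\<close>

lemma pmf_of_set_distinct_lists_Suc:
  assumes "finite E" "Suc r \<le> card E"
  shows "pmf_of_set (distinct_lists (Suc r) E) =
    bind_pmf (pmf_of_set E) (\<lambda>e. map_pmf ((#) e) (pmf_of_set (distinct_lists r (E - {e}))))"
proof -
  let ?f = "\<lambda>e. (#) e ` distinct_lists r (E - {e})"
  have card: "card (E - {e}) = card E - 1" if "e \<in> E" for e
    using assms that by simp
  have ne: "distinct_lists r (E - {e}) \<noteq> {}" if "e \<in> E" for e
    using assms card[OF that] by (intro distinct_lists_nonempty) auto
  have fin: "finite (distinct_lists r (E - {e}))" for e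
    using assms by (intro finite_distinct_lists) auto
  have eq: "distinct_lists (Suc r) E = (\<Union>e\<in>E. ?f e)"
  proof (intro equalityI subsetI)
    fix es assume es: "es \<in> distinct_lists (Suc r) E"
    then obtain e es' where es': "es = e # es'" by (auto simp: length_Suc_conv)
    then have "e \<in> E" "es' \<in> distinct_lists r (E - {e})" using es by auto
    then show "es \<in> (\<Union>e\<in>E. ?f e)" unfolding es' by blast
  qed auto
  have same: "card (?f e) = card (?f e')" if "e \<in> E" "e' \<in> E" for e e'
  proof -
    have "real (card (distinct_lists r (E - {e}))) = real (card (distinct_lists r (E - {e'})))"
      using assms card that by (subst (1 2) real_card_distinct_lists) auto
    then show ?thesis by (simp add: card_image)
  qed
  have "E \<noteq> {}" using assms(2) by auto
  then obtain e0 where e0: "e0 \<in> E" by blast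
  have "pmf_of_set (\<Union>e\<in>E. ?f e) = bind_pmf (pmf_of_set E) (\<lambda>e. pmf_of_set (?f e))"
  proof (rule pmf_of_set_UN)
    show "finite (\<Union>e\<in>E. ?f e)" by (intro finite_UN_I assms(1) finite_imageI fin)
    show "E \<noteq> {}" by fact
    show "?f e \<noteq> {}" if "e \<in> E" for e using ne[OF that] by (simp only: image_is_empty not_False_eq_True)
    show "card (?f e) = card (?f e0)" if "e \<in> E" for e by (rule same[OF that e0])
    show "disjoint_family_on ?f E" unfolding disjoint_family_on_def by blast
  qed
  also have "\<dots> = bind_pmf (pmf_of_set E)
      (\<lambda>e. map_pmf ((#) e) (pmf_of_set (distinct_lists r (E - {e}))))"
  proof (rule bind_pmf_cong[OF refl])
    fix e assume "e \<in> set_pmf (pmf_of_set E)"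
    then have "e \<in> E" using \<open>E \<noteq> {}\<close> assms(1) by simp
    then show "pmf_of_set (?f e) = map_pmf ((#) e) (pmf_of_set (distinct_lists r (E - {e})))"
      by (intro map_pmf_of_set_inj[symmetric] ne fin) simp
  qed
  finally show ?thesis unfolding eq .
qed

text \<open>Given its size r, the random set is uniform, and a uniform ordering makes it a uniform
  sequence. Both sides give a sequence of length r the probability p^r (1 - p)^(n - r) / r!.\<close>

lemma bind_random_subset_permutation:
  fixes S :: "'a set"
  assumes fin: "finite S" and p: "0 \<le> p" "p \<le> 1"
  shows "bind_pmf (Pi_pmf S False (\<lambda>_. bernoulli_pmf p))
      (\<lambda>f. pmf_of_set (permutations_of_set {e \<in> S. f e})) =
    bind_pmf (binomial_pmf (card S) p) (\<lambda>r. pmf_of_set (distinct_lists r S))" (is "?L = ?R")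
proof (rule pmf_eqI)
  fix es :: "'a list"
  let ?n = "card S" and ?r = "length es" and ?f = "\<lambda>x. x \<in> set es"
  have fin_sub: "finite {e \<in> S. f e}" for f using fin by simp
  have L: "pmf (pmf_of_set (permutations_of_set {e \<in> S. f e})) es =
      (if distinct es \<and> set es = {e \<in> S. f e} then 1 / fact ?r else 0)" for f
  proof -
    have "card {e \<in> S. f e} = ?r" if "distinct es" "set es = {e \<in> S. f e}"
      using that distinct_card by metis
    then show ?thesis
      using fin_sub[of f]
      by (subst pmf_of_set)
        (auto simp: permutations_of_set_empty_iff indicator_def permutations_of_setD
          intro: permutations_of_setI)
  qed
  \<comment> \<open>The restriction to the support ensures \<open>k \<le> ?n\<close>: for larger
    \<open>k\<close> the set of sequences is empty and \<open>pmf_of_set\<close> is not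
    specified.\<close>
  have R: "pmf (pmf_of_set (distinct_lists k S)) es =
      (if es \<in> distinct_lists k S then fact (?n - k) / fact ?n else 0)"
    if "k \<in> set_pmf (binomial_pmf ?n p)" for k
  proof -
    have "k \<le> ?n" using that p by (auto simp: set_pmf_binomial_eq split: if_splits)
    then show ?thesis
      using distinct_lists_nonempty[OF fin, of k] finite_distinct_lists[OF fin, of k]
      by (subst pmf_of_set) (auto simp: real_card_distinct_lists[OF fin] indicator_def)
  qed
  show "pmf ?L es = pmf ?R es"
  proof (cases "distinct es \<and> set es \<subseteq> S")
    case True
    have r: "?r \<le> ?n" using True fin by (metis card_mono distinct_card)
    have cards: "card (S \<inter> {x. ?f x}) = ?r" "card (S \<inter> - {x. ?f x}) = ?n - ?r"
    proof -
      have "S \<inter> {x. ?f x} = set es" using True by auto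
      then show "card (S \<inter> {x. ?f x}) = ?r" using True by (simp add: distinct_card)
      have "S \<inter> - {x. ?f x} = S - set es" by auto
      then show "card (S \<inter> - {x. ?f x}) = ?n - ?r"
        using True by (simp add: card_Diff_subset distinct_card)
    qed
    have "pmf ?L es = (\<Sum>f\<in>{?f}. (if distinct es \<and> set es = {e \<in> S. f e} then 1 / fact ?r else 0) *
        pmf (Pi_pmf S False (\<lambda>_. bernoulli_pmf p)) f)"
      unfolding pmf_bind L
    proof (rule integral_measure_pmf_real)
      fix f assume "f \<in> set_pmf (Pi_pmf S False (\<lambda>_. bernoulli_pmf p))"
        and "(if distinct es \<and> set es = {e \<in> S. f e} then 1 / fact ?r else (0 :: real)) \<noteq> 0"
      \<comment> \<open>The default value \<open>False\<close> outside \<open>S\<close> determines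
        \<open>f\<close> as a function, not merely on \<open>S\<close>.\<close>
      then show "f \<in> {?f}"
        using set_Pi_pmf_subset[OF fin, of False "\<lambda>_. bernoulli_pmf p"]
        by (auto split: if_splits)
    qed simp
    also have "\<dots> = 1 / fact ?r * pmf (Pi_pmf S False (\<lambda>_. bernoulli_pmf p)) ?f"
      using True by auto
    also have "pmf (Pi_pmf S False (\<lambda>_. bernoulli_pmf p)) ?f =
        (\<Prod>x\<in>S. if x \<in> set es then p else 1 - p)"
      using True p by (subst pmf_Pi'[OF fin]) (auto intro!: prod.cong)
    also have "\<dots> = p ^ ?r * (1 - p) ^ (?n - ?r)"
      using fin by (subst prod.If_cases) (auto simp only: prod_constant cards)
    finally have l: "pmf ?L es = 1 / fact ?r * (p ^ ?r * (1 - p) ^ (?n - ?r))" .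
    have "pmf ?R es = (\<Sum>k\<in>{?r}. pmf (pmf_of_set (distinct_lists k S)) es *
        pmf (binomial_pmf ?n p) k)"
      unfolding pmf_bind
      by (rule integral_measure_pmf_real) (auto simp: R split: if_splits)
    \<comment> \<open>For p = 0 or p = 1 the length of \<open>es\<close> may lie outside the
      binomial support; both sides are then 0.\<close>
    also have "\<dots> = fact (?n - ?r) / fact ?n * pmf (binomial_pmf ?n p) ?r"
    proof (cases "?r \<in> set_pmf (binomial_pmf ?n p)")
      case rs: True
      then show ?thesis using True by (simp add: R)
    next
      case False
      then show ?thesis by (simp add: set_pmf_iff)
    qed
    also have "\<dots> = fact (?n - ?r) / fact ?n * (real (?n choose ?r) * (p ^ ?r * (1 - p) ^ (?n - ?r)))"
      using p by (simp add: mult.assoc)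
    also have "\<dots> = 1 / fact ?r * (p ^ ?r * (1 - p) ^ (?n - ?r))"
      using r by (simp add: binomial_fact field_simps)
    finally show ?thesis using l by simp
  next
    case False
    have "pmf ?L es = 0"
      unfolding pmf_bind L using False
      by (intro integral_eq_zero_AE) (auto simp: AE_measure_pmf_iff)
    moreover have "pmf ?R es = 0"
      unfolding pmf_bind using False
      by (intro integral_eq_zero_AE) (auto simp: AE_measure_pmf_iff R)
    ultimately show ?thesis by simp
  qed
qed

section \<open>Rooted subtrees\<close>

abbreviation (input) induced :: "'l dforest \<Rightarrow> nat set \<Rightarrow> 'l dforest" where
  "induced T S \<equiv> T\<lparr>verts := S\<rparr>"

text \<open>In a rooted tree, a set containing the root is connected exactly when it is closed under
  parents; this is the form in which subtrees are handled afterwards.\<close>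

lemma rooted_subtrees_iff:
  assumes "rooted_tree T"
  shows "S \<in> rooted_subtrees T \<longleftrightarrow>
    S \<subseteq> verts T \<and> root T \<in> S \<and> (\<forall>v\<in>S. \<forall>u. par T v = Some u \<longrightarrow> u \<in> S)"
proof (intro iffI conjI ballI allI impI)
  let ?R = "child_rel T" and ?C = "(child_rel T \<union> (child_rel T)\<inverse>) \<inter> S \<times> S"
  assume S: "S \<in> rooted_subtrees T"
  then show "S \<subseteq> verts T" "root T \<in> S" by (auto simp: rooted_subtrees_def)
  fix v u assume v: "v \<in> S" "par T v = Some u"
  have "(root T, v) \<in> ?C\<^sup>*"
    using S v by (auto simp: rooted_subtrees_def connected_set_def)
  \<comment> \<open>The invariant along a path inside \<open>S\<close> is stronger than the goal:
    all ancestors of the current vertex lie in \<open>S\<close>. An upward step only loses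
    ancestors, and a downward step adds the new vertex alone.\<close>
  then have "\<forall>x. (x, v) \<in> ?R\<^sup>* \<longrightarrow> x \<in> S"
  proof (induction rule: rtrancl_induct)
    case base
    have "x = root T" if "(x, root T) \<in> ?R\<^sup>*" for x
      using that rooted_tree_root(2)[OF assms] by (cases rule: rtranclE) (auto simp: child_rel_def)
    then show ?case using \<open>root T \<in> S\<close> by blast
  next
    case (step y z)
    show ?case
    proof (cases "(y, z) \<in> ?R")
      case True
      show ?thesis
      proof (intro allI impI)
        fix x assume "(x, z) \<in> ?R\<^sup>*"
        then show "x \<in> S"
        proof (cases rule: rtranclE)
          case base
          then show ?thesis using step(2) by blast
        next
          case (step w)
          then have "w = y" using True by (meson par_unique)
          then show ?thesis using \<open>\<forall>x. (x, y) \<in> ?R\<^sup>* \<longrightarrow> x \<in> S\<close> step by blast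
        qed
      qed
    next
      case False
      then have "(z, y) \<in> ?R" using step by auto
      then show ?thesis using step.IH by (meson rtrancl.rtrancl_into_rtrancl)
    qed
  qed
  moreover have "(u, v) \<in> ?R"
    using v \<open>S \<subseteq> verts T\<close> by (auto simp: child_rel_def)
  ultimately show "u \<in> S" by blast
next
  let ?R = "child_rel T" and ?C = "(child_rel T \<union> (child_rel T)\<inverse>) \<inter> S \<times> S"
  assume S: "S \<subseteq> verts T \<and> root T \<in> S \<and> (\<forall>v\<in>S. \<forall>u. par T v = Some u \<longrightarrow> u \<in> S)"
  have wf: "wf ?R" using assms wf_child_rel by (auto simp: rooted_tree_def)
  have r: "(root T, v) \<in> ?C\<^sup>*" if "v \<in> S" for v
    using wf that
  proof (induction v rule: wf_induct_rule)
    case (less v)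
    show ?case
    proof (cases "par T v")
      case None
      then show ?thesis using rooted_tree_root(3)[OF assms] less S by auto
    next
      case (Some u)
      then have "u \<in> S" "(u, v) \<in> ?R" using less S by (auto simp: child_rel_def)
      then have "(root T, u) \<in> ?C\<^sup>*" "(u, v) \<in> ?C" using less by auto
      then show ?thesis by (rule rtrancl.rtrancl_into_rtrancl)
    qed
  qed
  have "sym (?C\<^sup>*)" by (rule sym_rtrancl) (auto simp: sym_def)
  then have "(u, v) \<in> ?C\<^sup>*" if "u \<in> S" "v \<in> S" for u v
    using r[OF that(1)] r[OF that(2)] by (meson rtrancl_trans symD)
  then show "S \<in> rooted_subtrees T"
    using S by (auto simp: rooted_subtrees_def connected_set_def)
qed

lemma rooted_tree_induced:
  assumes T: "rooted_tree T" and S: "S \<in> rooted_subtrees T"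
  shows "rooted_tree (induced T S)"
proof -
  have S': "S \<subseteq> verts T" "root T \<in> S" "\<And>u v. v \<in> S \<Longrightarrow> par T v = Some u \<Longrightarrow> u \<in> S"
    using S rooted_subtrees_iff[OF T] by auto
  have wf: "wf_forest T" using T by (simp add: rooted_tree_def)
  have "child_rel (induced T S) \<subseteq> child_rel T" using S' by (auto simp: child_rel_def)
  then have "acyclic (child_rel (induced T S))"
    using wf by (auto simp: wf_forest_def intro: acyclic_subset)
  then have "wf_forest (induced T S)"
    using wf S' by (auto simp: wf_forest_def dest: finite_subset)
  moreover have "\<exists>!v. v \<in> verts (induced T S) \<and> par (induced T S) v = None"
  proof (rule ex1I[of _ "root T"])
    show "root T \<in> verts (induced T S) \<and> par (induced T S) (root T) = None"
      using rooted_tree_root(2)[OF T] S'(2) by simp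
    show "v = root T" if "v \<in> verts (induced T S) \<and> par (induced T S) v = None" for v
      using that S'(1) by (intro rooted_tree_root(3)[OF T]) auto
  qed
  ultimately show ?thesis by (simp add: rooted_tree_def)
qed

text \<open>A leaf can coincide with the root only if nothing else is present, since every vertex is
  reachable from the root.\<close>

lemma rooted_subtrees_remove_leaf:
  assumes T: "rooted_tree T" and S: "S \<in> rooted_subtrees T" and v: "v \<in> leaves (induced T S)"
  shows "S - {v} \<in> rooted_subtrees T \<or> S = {v}"
proof (cases "v = root T")
  case False
  have "par T w \<noteq> Some v" if "w \<in> S" for w
    using v that by (auto simp: leaves_def children_def child_rel_def)
  then show ?thesis
    using S False by (auto simp: rooted_subtrees_iff[OF T])
next
  case True
  have I: "rooted_tree (induced T S)" using rooted_tree_induced[OF T S] .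
  have r: "root (induced T S) = root T"
    using rooted_tree_root(3)[OF I, of "root T"] rooted_tree_root(2)[OF T] S
    by (auto simp: rooted_subtrees_def)
  have "w = v" if "w \<in> S" for w
  proof -
    have "(v, w) \<in> (child_rel (induced T S))\<^sup>*"
      using rooted_tree_reachable[OF I, of w] that r True by simp
    then show ?thesis
      using v by (cases rule: converse_rtranclE) (auto simp: leaves_def children_def)
  qed
  then show ?thesis using S True by (auto simp: rooted_subtrees_def)
qed

lemma finite_rooted_subtrees: "rooted_tree T \<Longrightarrow> finite (rooted_subtrees T)"
  by (rule finite_subset[of _ "Pow (verts T)"])
    (auto simp: rooted_subtrees_def rooted_tree_def wf_forest_finite)

lemma verts_in_rooted_subtrees:
  assumes "rooted_tree T"
  shows "verts T \<in> rooted_subtrees T"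
  using rooted_tree_root(1)[OF assms] assms wf_forest_parD
  by (auto simp: rooted_subtrees_iff rooted_tree_def)

section \<open>Firing uniformly chosen employees\<close>

text \<open>The firing chain on positions alone, with the employees forgotten; the guard for the
  boss is the one in \<open>fire\<close>.\<close>

definition fire_step :: "'l dforest \<Rightarrow> nat set \<Rightarrow> nat set pmf" where
  "fire_step T S = (if card S = 1 then return_pmf S else hook_walk (induced T S))"

primrec fire_steps :: "'l dforest \<Rightarrow> nat \<Rightarrow> nat set \<Rightarrow> nat set pmf" where
  "fire_steps T 0 S = return_pmf S"
| "fire_steps T (Suc r) S = bind_pmf (fire_step T S) (fire_steps T r)"

locale company =
  fixes T0 :: "'l dforest"
  assumes rooted: "rooted_tree T0"
begin

abbreviation subtrees :: "nat set set" where
  "subtrees \<equiv> rooted_subtrees T0"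

abbreviation class_of :: "nat set \<Rightarrow> 'l forest" where
  "class_of S \<equiv> abs_forest (induced T0 S)"

abbreviation weight :: "nat set \<Rightarrow> real" where
  "weight S \<equiv> inv_hooks (induced T0 S)"

lemma wf_T0: "wf_forest T0"
  using rooted by (simp add: rooted_tree_def)

lemma wf_induced: "S \<in> subtrees \<Longrightarrow> wf_forest (induced T0 S)"
  using rooted_tree_induced[OF rooted] by (auto simp: rooted_tree_def)

lemma finite_subtree: "S \<in> subtrees \<Longrightarrow> finite S"
  using wf_forest_finite[OF wf_T0] by (auto simp: rooted_subtrees_def intro: finite_subset)

lemma card_subtree_pos: "S \<in> subtrees \<Longrightarrow> card S > 0"
  using finite_subtree by (auto simp: card_gt_0_iff rooted_subtrees_def)

lemma card_subtree_le: "S \<in> subtrees \<Longrightarrow> card S \<le> card (verts T0)"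
  using wf_forest_finite[OF wf_T0] by (auto simp: rooted_subtrees_def intro: card_mono)

lemma del_vertex_induced: "del_vertex (induced T0 S) v = induced T0 (S - {v})"
  by (simp add: del_vertex_def)

lemma remove_leaf_subtree:
  "S \<in> subtrees \<Longrightarrow> v \<in> leaves (induced T0 S) \<Longrightarrow> card S \<noteq> 1 \<Longrightarrow> S - {v} \<in> subtrees"
  using rooted_subtrees_remove_leaf[OF rooted, of S v] by auto

lemma leaf_sum_class_of:
  "S \<in> subtrees \<Longrightarrow>
   leaf_sum (class_of S) g = (\<Sum>v\<in>leaves (induced T0 S). g (class_of (S - {v})))"
  by (simp add: leaf_sum_abs wf_induced del_vertex_induced)

lemma deg_class_of: "S \<in> subtrees \<Longrightarrow> deg (class_of S) = card S"
  by (simp add: deg_abs wf_induced)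

lemma set_fire_step:
  assumes "S \<in> subtrees"
  shows "set_pmf (fire_step T0 S) \<subseteq> {S' \<in> subtrees. S' \<subseteq> S}"
proof (cases "card S = 1")
  case True
  then show ?thesis using assms by (simp add: fire_step_def)
next
  case False
  then have "set_pmf (fire_step T0 S) \<subseteq> (\<lambda>l. S - {l}) ` leaves (induced T0 S)"
    using set_hook_walk[OF rooted_tree_induced[OF rooted assms]] by (simp add: fire_step_def)
  then show ?thesis using remove_leaf_subtree[OF assms _ False] by blast
qed

lemma set_fire_steps: "S \<in> subtrees \<Longrightarrow> set_pmf (fire_steps T0 r S) \<subseteq> {S' \<in> subtrees. S' \<subseteq> S}"
proof (induction r arbitrary: S)
  case (Suc r)
  show ?case
  proof
    fix S' assume "S' \<in> set_pmf (fire_steps T0 (Suc r) S)"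
    then obtain S1 where S1: "S1 \<in> set_pmf (fire_step T0 S)" "S' \<in> set_pmf (fire_steps T0 r S1)"
      by auto
    then have "S1 \<in> subtrees" "S1 \<subseteq> S" using set_fire_step[OF Suc.prems] by auto
    then show "S' \<in> {S' \<in> subtrees. S' \<subseteq> S}" using Suc.IH[of S1] S1 by blast
  qed
qed simp

section \<open>From named employees to uniform positions\<close>

lemma the_position:
  assumes "bij_betw occ S E" "v \<in> S"
  shows "(THE w. w \<in> S \<and> occ w = occ v) = v"
  using assms by (intro the_equality) (auto simp: bij_betw_def inj_on_def)

text \<open>The set \<open>E\<close> of employees may differ from \<open>S\<close> after promotions;
  the seating bijection carries the uniform distribution on \<open>E\<close> to the one on
  \<open>S\<close>.\<close>

lemma bind_uniform_fire:
  assumes S: "S \<in> subtrees" and occ: "bij_betw occ S E"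
  shows "bind_pmf (pmf_of_set E) (\<lambda>e. map_pmf fst (fire T0 e (S, occ))) = fire_step T0 S"
proof (cases "card S = 1")
  case True
  then show ?thesis by (simp add: fire_def fire_step_def)
next
  case False
  have ne: "S \<noteq> {}" "finite S" using S finite_subtree by (auto simp: rooted_subtrees_def)
  have "bind_pmf (pmf_of_set E) (\<lambda>e. map_pmf fst (fire T0 e (S, occ))) =
      bind_pmf (pmf_of_set S) (\<lambda>v. map_pmf fst (fire T0 (occ v) (S, occ)))"
    unfolding map_pmf_of_set_bij_betw[OF occ ne, symmetric] by (simp add: bind_map_pmf)
  also have "\<dots> = bind_pmf (pmf_of_set S) (vacate (induced T0 S))"
    using ne False
    by (intro bind_pmf_cong refl) (simp add: fire_def the_position[OF occ] map_fst_cascade)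
  finally show ?thesis using False by (simp add: fire_step_def hook_walk_def)
qed

text \<open>This is the invariant for repeated firing: everyone except the fired employee is again
  seated bijectively on a rooted subtree.\<close>

lemma fire_support:
  assumes S: "S \<in> subtrees" "card S \<noteq> 1" and occ: "bij_betw occ S E" and e: "e \<in> E"
    and c: "(S', occ') \<in> set_pmf (fire T0 e (S, occ))"
  shows "S' \<in> subtrees" "card S = Suc (card S')" "bij_betw occ' S' (E - {e})"
proof -
  obtain v where v: "v \<in> S" "e = occ v" using occ e by (auto simp: bij_betw_def)
  have inj: "inj_on occ S" using occ by (simp add: bij_betw_def)
  have "(S', occ') \<in> set_pmf (cascade (induced T0 S) occ v)"
    using c S v by (simp add: fire_def the_position[OF occ])
  moreover have "inj_on occ (S - {v})" using inj by (rule inj_on_subset) auto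
  ultimately obtain l where l: "l \<in> leaves (induced T0 S)" "S' = S - {l}"
    "inj_on occ' S'" "occ' ` S' = occ ` (S - {v})"
    using cascade_support[of S' occ' "induced T0 S" occ v] wf_induced[OF S(1)] v by auto
  show "S' \<in> subtrees" using remove_leaf_subtree[OF S(1) l(1) S(2)] l by simp
  have "l \<in> S" using l by (simp add: leaves_def)
  then show "card S = Suc (card S')"
    using l(2) finite_subtree[OF S(1)] card_subtree_pos[OF S(1)] by simp
  have "occ ` (S - {v}) = E - {e}"
    using occ v inj by (auto simp: bij_betw_def inj_on_def)
  then show "bij_betw occ' S' (E - {e})" using l by (simp add: bij_betw_def)
qed

lemma bind_uniform_fire_list:
  assumes "S \<in> subtrees" "bij_betw occ S E" "r \<le> card S"
  shows "bind_pmf (pmf_of_set (distinct_lists r E)) (\<lambda>es. map_pmf fst (fire_list T0 es (S, occ))) =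
    fire_steps T0 r S"
  using assms
proof (induction r arbitrary: S occ E)
  case 0
  have "distinct_lists 0 E = {[]}" by auto
  then show ?case by (simp add: pmf_of_set_singleton bind_return_pmf)
next
  case (Suc r)
  let ?D = "\<lambda>e. pmf_of_set (distinct_lists r (E - {e}))"
  have E: "finite E" "card E = card S"
    using Suc.prems finite_subtree by (auto dest: bij_betw_same_card bij_betw_finite)
  have "E \<noteq> {}" using E Suc.prems by fastforce
  then have supp: "set_pmf (pmf_of_set E) = E" using E by simp
  have inner: "bind_pmf (?D e) (\<lambda>es. map_pmf fst (fire_list T0 es c)) = fire_steps T0 r (fst c)"
    if e: "e \<in> E" and c: "c \<in> set_pmf (fire T0 e (S, occ))" for e c
  \<comment> \<open>For the boss alone nobody leaves, so the invariant fails; but then no firing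
    remains after this one, as \<open>Suc r \<le> card S\<close> forces
    \<open>r = 0\<close>.\<close>
  proof (cases "card S = 1")
    case True
    then have r: "r = 0" using Suc.prems by simp
    have "distinct_lists 0 (E - {e}) = {[]}" by auto
    then show ?thesis by (simp add: r pmf_of_set_singleton bind_return_pmf)
  next
    case False
    obtain S' occ' where c': "c = (S', occ')" by fastforce
    note f = fire_support[OF Suc.prems(1) False Suc.prems(2) e c[unfolded c']]
    show ?thesis unfolding c' fst_conv
      using Suc.IH[OF f(1,3)] f(2) Suc.prems(3) by simp
  qed
  have "bind_pmf (pmf_of_set (distinct_lists (Suc r) E))
      (\<lambda>es. map_pmf fst (fire_list T0 es (S, occ))) =
    bind_pmf (pmf_of_set E) (\<lambda>e. bind_pmf (?D e)
      (\<lambda>es. bind_pmf (fire T0 e (S, occ)) (\<lambda>c. map_pmf fst (fire_list T0 es c))))"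
    using E Suc.prems
    by (subst pmf_of_set_distinct_lists_Suc)
      (auto simp: bind_assoc_pmf bind_map_pmf map_bind_pmf)
  \<comment> \<open>The remaining names are independent of the cascade, so they may be drawn after
    it; the induction hypothesis then applies to each resulting configuration.\<close>
  also have "\<dots> = bind_pmf (pmf_of_set E) (\<lambda>e. bind_pmf (fire T0 e (S, occ))
      (\<lambda>c. bind_pmf (?D e) (\<lambda>es. map_pmf fst (fire_list T0 es c))))"
    by (subst bind_commute_pmf) (rule refl)
  also have "\<dots> = bind_pmf (pmf_of_set E) (\<lambda>e. bind_pmf (fire T0 e (S, occ))
      (\<lambda>c. fire_steps T0 r (fst c)))"
    by (intro bind_pmf_cong refl inner) (simp_all add: supp)
  also have "\<dots> = bind_pmf (bind_pmf (pmf_of_set E) (\<lambda>e. map_pmf fst (fire T0 e (S, occ))))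
      (fire_steps T0 r)"
    by (simp add: bind_assoc_pmf bind_map_pmf)
  also have "\<dots> = fire_steps T0 (Suc r) S"
    using bind_uniform_fire[OF Suc.prems(1,2)] by simp
  finally show ?case .
qed

lemma single_model_eq:
  assumes "S \<in> subtrees"
  shows "single_model T0 S = bind_pmf (bernoulli_pmf (real (card S) / real (card (verts T0))))
    (\<lambda>b. if b then fire_step T0 S else return_pmf S)"
  unfolding single_model_def bind_uniform_fire[OF assms bij_betw_id] by (rule refl)

lemma binomial_model_eq:
  assumes S: "S \<in> subtrees" and q: "0 \<le> q" "q \<le> 1"
  shows "binomial_model T0 q S =
    bind_pmf (binomial_pmf (card S) (1 - q)) (\<lambda>r. fire_steps T0 r S)"
proof -
  let ?F = "\<lambda>es. map_pmf fst (fire_list T0 es (S, id))"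
  have "binomial_model T0 q S =
      bind_pmf (bind_pmf (Pi_pmf S False (\<lambda>_. bernoulli_pmf (1 - q)))
        (\<lambda>f. pmf_of_set (permutations_of_set {e \<in> S. f e}))) ?F"
    by (simp add: binomial_model_def bind_assoc_pmf)
  also have "\<dots> = bind_pmf (binomial_pmf (card S) (1 - q))
      (\<lambda>r. bind_pmf (pmf_of_set (distinct_lists r S)) ?F)"
    using q finite_subtree[OF S]
    by (subst bind_random_subset_permutation) (simp_all add: bind_assoc_pmf)
  also have "\<dots> = bind_pmf (binomial_pmf (card S) (1 - q)) (\<lambda>r. fire_steps T0 r S)"
    using q
    by (intro bind_pmf_cong refl bind_uniform_fire_list[OF S])
      (auto simp: set_pmf_binomial_eq split: if_splits)
  finally show ?thesis .
qed

section \<open>The algebra restricted to rooted subtrees\<close>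

lemma class_of_empty: "class_of {} = 0"
proof -
  have "wf_forest (induced T0 {})"
    by (simp add: wf_forest_def child_rel_def acyclic_def)
  then have "forest_iso (induced T0 {}) empty_df"
    using wf_forest_empty by (auto simp: forest_iso_def forest_iso_by_def empty_df_def)
  then show ?thesis by (simp add: abs_forest_eqI zero_forest_def)
qed

lemma class_of_root:
  assumes S: "S \<in> subtrees" "card S = 1"
  shows "class_of S = dot"
proof -
  have r: "S = {root T0}" using S by (auto simp: rooted_subtrees_def card_1_singleton_iff)
  have "lab T0 (root T0) = None"
    using wf_T0 rooted_tree_root(1,2)[OF rooted] by (auto simp: wf_forest_def)
  then have "forest_iso_by (\<lambda>_. 0) (induced T0 S) dot_df"
    using rooted_tree_root(2)[OF rooted] by (simp add: forest_iso_by_def dot_df_def r bij_betw_def)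
  then have "forest_iso (induced T0 S) dot_df"
    using wf_induced[OF S(1)] wf_forest_dot by (auto simp: forest_iso_def)
  then show ?thesis by (simp add: abs_forest_eqI dot_def)
qed

lemma eta_dots_class_of:
  assumes "S \<in> subtrees \<or> S = {}"
  shows "real (eta (dots k + class_of S)) = fact (k + card S) * weight S"
  using assms
proof (induction "k + card S" arbitrary: k S rule: less_induct)
  case less
  have deg: "deg (dots k + class_of S) = k + card S"
    using less.prems by (auto simp: deg_plus deg_class_of class_of_empty)
  show ?case
  proof (cases "k + card S = 0")
    case True
    then have "k = 0" "S = {}" using less.prems card_subtree_pos[of S] by auto
    then show ?thesis by (simp add: class_of_empty eta_zero inv_hooks_def)
  next
    case False
    let ?m = "k + card S - 1"
    have m: "fact (k + card S) = (real k + real (card S)) * fact ?m"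
      using fact_reduce[of "k + card S", where 'a = real] False by simp
    have "real (eta (dots k + class_of S)) =
        real k * real (eta (dots (k - 1) + class_of S)) +
        leaf_sum (class_of S) (\<lambda>z. real (eta (dots k + z)))"
      using False deg by (subst eta_leaf_sum) (auto simp: leaf_sum_dots_plus)
    also have "real k * real (eta (dots (k - 1) + class_of S)) = real k * (fact ?m * weight S)"
    proof (cases "k = 0")
      case False
      then show ?thesis using less.hyps[of "k - 1" S] less.prems by (cases k) auto
    qed simp
    also have "leaf_sum (class_of S) (\<lambda>z. real (eta (dots k + z))) =
        real (card S) * (fact ?m * weight S)"
    proof (cases "S = {}")
      case True
      then show ?thesis by (simp add: class_of_empty leaf_sum_deg_0)
    next
      case ne: False
      then have S: "S \<in> subtrees" using less.prems by simp
      have "real (eta (dots k + class_of (S - {v}))) = fact ?m * weight (S - {v})"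
        if v: "v \<in> leaves (induced T0 S)" for v
      proof -
        have "v \<in> S" using v by (simp add: leaves_def)
        then have c: "card S = Suc (card (S - {v}))"
          using finite_subtree[OF S] card_subtree_pos[OF S] by simp
        have "S - {v} \<in> subtrees \<or> S - {v} = {}"
          using rooted_subtrees_remove_leaf[OF rooted S v] by auto
        then show ?thesis using less.hyps[of k "S - {v}"] c by simp
      qed
      then have "leaf_sum (class_of S) (\<lambda>z. real (eta (dots k + z))) =
          fact ?m * (\<Sum>v\<in>leaves (induced T0 S). weight (S - {v}))"
        by (simp add: leaf_sum_class_of[OF S] sum_distrib_left)
      also have "(\<Sum>v\<in>leaves (induced T0 S). weight (S - {v})) = real (card S) * weight S"
        using sum_inv_hooks_del_leaf[OF rooted_tree_induced[OF rooted S]]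
        by (simp add: del_vertex_induced)
      finally show ?thesis by simp
    qed
    finally show ?thesis unfolding m by (simp add: algebra_simps)
  qed
qed

text \<open>The factorial is the same for all states, so the quotient of two \<open>eta\<close>
  values is the quotient of the weights.\<close>

lemma eta_add_dots: "S \<in> subtrees \<Longrightarrow> real (eta (add_dots T0 S)) = fact (card (verts T0)) * weight S"
  using eta_dots_class_of[of S "card (verts T0) - card S"] card_subtree_le[of S]
  by (simp add: add_dots_def)

section \<open>Firing probabilities as coefficients of leaf removal\<close>

lemma pmf_fire_steps_Suc:
  assumes S: "S \<in> subtrees" "card S \<noteq> 1"
  shows "pmf (fire_steps T0 (Suc r) S) S' =
    (\<Sum>v\<in>leaves (induced T0 S). pmf (hook_walk (induced T0 S)) (S - {v}) *
      pmf (fire_steps T0 r (S - {v})) S')"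
proof -
  let ?L = "leaves (induced T0 S)"
  have fin: "finite ?L" using finite_subtree[OF S(1)] by (simp add: leaves_def)
  have "pmf (fire_steps T0 (Suc r) S) S' = (\<Sum>U\<in>(\<lambda>v. S - {v}) ` ?L.
      pmf (fire_steps T0 r U) S' * pmf (hook_walk (induced T0 S)) U)"
    using set_hook_walk[OF rooted_tree_induced[OF rooted S(1)]] fin S(2)
    by (simp add: fire_step_def pmf_bind) (intro integral_measure_pmf_real, auto)
  also have "\<dots> = (\<Sum>v\<in>?L. pmf (hook_walk (induced T0 S)) (S - {v}) *
      pmf (fire_steps T0 r (S - {v})) S')"
    using inj_on_remove_leaf[of "induced T0 S"] by (subst sum.reindex) (auto simp: mult.commute)
  finally show ?thesis .
qed

text \<open>The falling factorial counts ordered choices of \<open>r\<close> employees, and the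
  quotient of weights undoes the Doob transform; the result is the coefficient contributed by
  \<open>S'\<close> to \<open>r\<close> leaf removals.\<close>

definition steps_coeff :: "nat \<Rightarrow> nat set \<Rightarrow> nat set \<Rightarrow> real" where
  "steps_coeff r S S' =
     fact (card S) / fact (card S - r) * pmf (fire_steps T0 r S) S' * weight S / weight S'"

lemma steps_coeff_0: "S \<in> subtrees \<Longrightarrow> steps_coeff 0 S S' = (if S' = S then 1 else 0)"
  using inv_hooks_pos[of "induced T0 S"] by (auto simp: steps_coeff_def)

text \<open>The hook walk identity trades the weight of \<open>S - {v}\<close> for n times that of
  \<open>S\<close> and the probability of deleting \<open>v\<close>. The factor n extends the
  falling factorial, so the coefficients obey the recursion of leaf removal.\<close>

lemma steps_coeff_Suc:
  assumes S: "S \<in> subtrees" "card S \<noteq> 1" and r: "Suc r \<le> card S"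
  shows "steps_coeff (Suc r) S S' = (\<Sum>v\<in>leaves (induced T0 S). steps_coeff r (S - {v}) S')"
proof -
  let ?L = "leaves (induced T0 S)" and ?n = "card S"
  have n: "fact ?n = real ?n * fact (?n - 1)"
    using fact_reduce[of ?n, where 'a = real] card_subtree_pos[OF S(1)] by simp
  have "steps_coeff r (S - {v}) S' = fact ?n / fact (?n - Suc r) *
      (pmf (hook_walk (induced T0 S)) (S - {v}) * pmf (fire_steps T0 r (S - {v})) S') *
      weight S / weight S'"
    if v: "v \<in> ?L" for v
  proof -
    have "v \<in> S" using v by (simp add: leaves_def)
    then have c: "card (S - {v}) = ?n - 1"
      using finite_subtree[OF S(1)] by simp
    have "weight (S - {v}) = real ?n * weight S * pmf (hook_walk (induced T0 S)) (S - {v})"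
      using pmf_hook_walk[OF rooted_tree_induced[OF rooted S(1)] v] by (simp add: del_vertex_induced)
    then show ?thesis unfolding steps_coeff_def c n by simp
  qed
  then have "(\<Sum>v\<in>?L. steps_coeff r (S - {v}) S') = fact ?n / fact (?n - Suc r) *
      (\<Sum>v\<in>?L. pmf (hook_walk (induced T0 S)) (S - {v}) * pmf (fire_steps T0 r (S - {v})) S') *
      weight S / weight S'"
    by (simp add: sum_distrib_left sum_distrib_right sum_divide_distrib)
  then show ?thesis
    unfolding pmf_fire_steps_Suc[OF S, symmetric] by (simp add: steps_coeff_def)
qed

lemma mDelta_class_of:
  assumes "S \<in> subtrees" "r \<le> card S"
  shows "mDelta r (bas (class_of S)) =
    (\<Sum>S'\<in>subtrees. Poly_Mapping.single (dots (card S - card S') + class_of S') (steps_coeff r S S'))"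
  using assms
proof (induction r arbitrary: S)
  case 0
  have "(\<Sum>S'\<in>subtrees. Poly_Mapping.single (dots (card S - card S') + class_of S')
      (steps_coeff 0 S S')) = (\<Sum>S'\<in>subtrees. if S' = S then bas (class_of S) else 0)"
    using 0 by (intro sum.cong) (auto simp: steps_coeff_0)
  then show ?case using 0 finite_rooted_subtrees[OF rooted] by simp
next
  case (Suc r)
  show ?case
  \<comment> \<open>Removing the only vertex leaves the empty forest, and the factor
    \<open>dot\<close> restores the boss; this agrees with the firing that is not carried
    out.\<close>
  proof (cases "card S = 1")
    case True
    then have r: "r = 0" using Suc.prems by simp
    have "steps_coeff (Suc 0) S S' = (if S' = S then 1 else 0)" for S'
      using inv_hooks_pos[of "induced T0 S"] True
      by (auto simp: steps_coeff_def fire_step_def bind_return_pmf)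
    then have "(\<Sum>S'\<in>subtrees. Poly_Mapping.single (dots (card S - card S') + class_of S')
        (steps_coeff (Suc 0) S S')) = (\<Sum>S'\<in>subtrees. if S' = S then bas (class_of S) else 0)"
      by (intro sum.cong) auto
    moreover have "mDelta (Suc 0) (bas (class_of S)) = bas (class_of S)"
      using class_of_root[OF Suc.prems(1) True]
      by (simp add: mDelta_Suc leaf_sum_dot mult_single)
    ultimately show ?thesis
      using Suc.prems finite_rooted_subtrees[OF rooted] by (simp add: r)
  next
    case False
    let ?L = "leaves (induced T0 S)"
    have "bas dot * mDelta r (bas (class_of (S - {v}))) =
        (\<Sum>S'\<in>subtrees. Poly_Mapping.single (dots (card S - card S') + class_of S')
          (steps_coeff r (S - {v}) S'))"
      if v: "v \<in> ?L" for v
    proof -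
      have "v \<in> S" using v by (simp add: leaves_def)
      then have c: "card S = Suc (card (S - {v}))"
        using finite_subtree[OF Suc.prems(1)] card_subtree_pos[OF Suc.prems(1)] by simp
      have Sv: "S - {v} \<in> subtrees" by (rule remove_leaf_subtree[OF Suc.prems(1) v False])
      have "Poly_Mapping.single (dot + (dots (card (S - {v}) - card S') + class_of S'))
            (steps_coeff r (S - {v}) S') =
          Poly_Mapping.single (dots (card S - card S') + class_of S') (steps_coeff r (S - {v}) S')"
        if S': "S' \<in> subtrees" for S'
      \<comment> \<open>Absorbing one more dot needs \<open>card S' \<le> card (S - {v})\<close>
        because subtraction is truncated; for unreachable \<open>S'\<close> the coefficient is
        0.\<close>
      proof (cases "S' \<in> set_pmf (fire_steps T0 r (S - {v}))")
        case True
        then have "S' \<subseteq> S - {v}" using set_fire_steps[OF Sv] by blast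
        then have "card S' \<le> card (S - {v})" using finite_subtree[OF Sv] by (rule card_mono[rotated])
        then have "card S - card S' = Suc (card (S - {v}) - card S')" using c by simp
        then show ?thesis by (simp only: replicate_Suc sum_list.Cons add.assoc)
      next
        case False
        then have "steps_coeff r (S - {v}) S' = 0" by (simp add: steps_coeff_def set_pmf_iff)
        then show ?thesis by simp
      qed
      then show ?thesis
        using Suc.IH[OF Sv] c Suc.prems(2) by (simp add: sum_distrib_left mult_single)
    qed
    then have "mDelta (Suc r) (bas (class_of S)) =
        (\<Sum>v\<in>?L. \<Sum>S'\<in>subtrees. Poly_Mapping.single (dots (card S - card S') + class_of S')
          (steps_coeff r (S - {v}) S'))"
      by (simp add: mDelta_Suc leaf_sum_class_of[OF Suc.prems(1)] sum_distrib_left)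
    then show ?thesis
      by (subst (asm) sum.swap)
        (simp add: steps_coeff_Suc[OF Suc.prems(1) False Suc.prems(2)] single_sum)
  qed
qed

section \<open>Comparison of the operators with the transition kernels\<close>

lemma bas_dots_times_single:
  assumes "S \<in> subtrees" "S' \<in> subtrees" "c \<noteq> 0 \<Longrightarrow> S' \<subseteq> S"
  shows "bas (dots (card (verts T0) - card S)) *
      Poly_Mapping.single (dots (card S - card S') + class_of S') c =
    Poly_Mapping.single (add_dots T0 S') c"
proof (cases "c = 0")
  case False
  then have "card S' \<le> card S" using assms finite_subtree card_mono by blast
  then have "card (verts T0) - card S' = (card (verts T0) - card S) + (card S - card S')"
    using card_subtree_le[OF assms(1)] by simp
  then show ?thesis by (simp only: add_dots_def mult_single dots_add add.assoc mult_1)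
qed simp

lemma dots_times_mDelta_class_of:
  assumes "S \<in> subtrees" "r \<le> card S"
  shows "bas (dots (card (verts T0) - card S)) * mDelta r (bas (class_of S)) =
    (\<Sum>S'\<in>subtrees. Poly_Mapping.single (add_dots T0 S') (steps_coeff r S S'))"
proof -
  have "S' \<subseteq> S" if "steps_coeff r S S' \<noteq> 0" for S'
  proof -
    have "S' \<in> set_pmf (fire_steps T0 r S)" using that by (auto simp: steps_coeff_def set_pmf_iff)
    then show ?thesis using set_fire_steps[OF assms(1)] by blast
  qed
  then show ?thesis
    unfolding mDelta_class_of[OF assms] sum_distrib_left
    using assms by (intro sum.cong refl bas_dots_times_single)
qed

text \<open>An identity in the algebra rather than between coefficients: the coefficient of a class
  collects all subtrees in that class until injectivity of \<open>add_dots\<close> separates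
  them.\<close>

definition driven_by :: "('l ckh \<Rightarrow> 'l ckh) \<Rightarrow> (nat set \<Rightarrow> nat set pmf) \<Rightarrow> bool" where
  "driven_by T P \<longleftrightarrow> (\<forall>S\<in>subtrees. T (bas (add_dots T0 S)) =
     (\<Sum>S'\<in>subtrees. Poly_Mapping.single (add_dots T0 S') (pmf (P S) S' * weight S / weight S')))"

text \<open>One removal acts on a tree vertex with total weight n / n0 and on a dot with weight (n0
  - n) / n0; these are the two branches of the Bernoulli choice.\<close>

lemma driven_by_T2R: "driven_by (T2R (card (verts T0))) (single_model T0)"
  unfolding driven_by_def
proof
  fix S assume S: "S \<in> subtrees"
  let ?N = "card (verts T0)" and ?n = "card S"
  let ?s = "\<lambda>S'. Poly_Mapping.single (add_dots T0 S')"
  have N: "?n \<le> ?N" "0 < ?n" using card_subtree_le[OF S] card_subtree_pos[OF S] by auto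
  have "T2R ?N (bas (add_dots T0 S)) = smul (1 / ?N)
      (bas (dots (?N - ?n)) * mDelta 1 (bas (class_of S)) +
       smul (real (?N - ?n)) (bas (dots (?N - ?n)) * bas (class_of S)))"
    by (simp add: T2R_def add_dots_def mDelta_1_dots_plus[unfolded One_nat_def] distrib_left
        times_smul)
  also have "bas (dots (?N - ?n)) * mDelta 1 (bas (class_of S)) =
      (\<Sum>S'\<in>subtrees. ?s S' (steps_coeff 1 S S'))"
    by (rule dots_times_mDelta_class_of) (use S N in auto)
  also have "bas (dots (?N - ?n)) * bas (class_of S) =
      (\<Sum>S'\<in>subtrees. ?s S' (steps_coeff 0 S S'))"
    using dots_times_mDelta_class_of[OF S, of 0] by simp
  also have "smul (1 / ?N) ((\<Sum>S'\<in>subtrees. ?s S' (steps_coeff 1 S S')) +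
        smul (real (?N - ?n)) (\<Sum>S'\<in>subtrees. ?s S' (steps_coeff 0 S S'))) =
      (\<Sum>S'\<in>subtrees. ?s S' (1 / ?N * (steps_coeff 1 S S' + real (?N - ?n) * steps_coeff 0 S S')))"
    by (simp only: smul_sum smul_add_right smul_single sum.distrib[symmetric] single_add[symmetric]
        distrib_left)
  also have "\<dots> = (\<Sum>S'\<in>subtrees. ?s S' (pmf (single_model T0 S) S' * weight S / weight S'))"
  proof (intro sum.cong refl arg_cong[where f = "?s _"])
    fix S'
    let ?w = "weight S / weight S'"
    have model: "pmf (single_model T0 S) S' = real ?n / ?N * pmf (fire_step T0 S) S' +
        (1 - real ?n / ?N) * pmf (return_pmf S) S'"
      unfolding single_model_eq[OF S] pmf_bind using N by simp
    have "fact ?n = real ?n * fact (?n - 1)"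
      using fact_reduce[of ?n, where 'a = real] N by simp
    moreover have "fire_steps T0 0 = return_pmf" by (rule ext) simp
    ultimately have c1: "steps_coeff 1 S S' = real ?n * pmf (fire_step T0 S) S' * ?w"
      by (simp add: steps_coeff_def bind_return_pmf')
    have c0: "steps_coeff 0 S S' = pmf (return_pmf S) S' * ?w"
      by (simp add: steps_coeff_def)
    have mix: "1 / N * (n * a * w + (N - n) * (b * w)) = (n / N * a + (1 - n / N) * b) * w"
      if "N \<noteq> 0" for N n a b w :: real
      using that by (simp add: field_simps)
    have "real ?N \<noteq> 0" using N by simp
    from mix[OF this, of "real ?n" "pmf (fire_step T0 S) S'" ?w "pmf (return_pmf S) S'"]
    show "1 / ?N * (steps_coeff 1 S S' + real (?N - ?n) * steps_coeff 0 S S') =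
        pmf (single_model T0 S) S' * weight S / weight S'"
      unfolding c1 c0 model of_nat_diff[OF N(1)] by (simp only: times_divide_eq_right)
  qed
  finally show "T2R ?N (bas (add_dots T0 S)) =
      (\<Sum>S'\<in>subtrees. ?s S' (pmf (single_model T0 S) S' * weight S / weight S'))" .
qed

text \<open>Once the dots are split off, 1 / r! times the falling factorial in
  \<open>steps_coeff\<close> is a binomial coefficient, so the number of firings is binomial with
  parameters \<open>card S\<close> and \<open>1 - q\<close>.\<close>

lemma driven_by_BinT2R:
  assumes q: "0 \<le> q" "q \<le> 1"
  shows "driven_by (BinT2R (card (verts T0)) q) (binomial_model T0 q)"
  unfolding driven_by_def
proof
  fix S assume S: "S \<in> subtrees"
  let ?N = "card (verts T0)" and ?n = "card S"
  let ?s = "\<lambda>S'. Poly_Mapping.single (add_dots T0 S')"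
  define c where "c r = 1 / fact r * (1 - q) ^ r * q ^ (?n - r)" for r
  have N: "?N - ?n + deg (class_of S) = ?N"
    using card_subtree_le[OF S] by (simp add: deg_class_of[OF S])
  have "BinT2R ?N q (bas (add_dots T0 S)) =
      bas (dots (?N - ?n)) * BinT2R ?n q (bas (class_of S))"
    using BinT2R_dots_plus[of "?N - ?n" "class_of S" q] unfolding N
    by (simp add: add_dots_def deg_class_of[OF S])
  also have "\<dots> = (\<Sum>r\<le>?n. smul (c r) (bas (dots (?N - ?n)) * mDelta r (bas (class_of S))))"
    by (simp add: BinT2R_def c_def sum_distrib_left times_smul)
  also have "\<dots> = (\<Sum>r\<le>?n. smul (c r) (\<Sum>S'\<in>subtrees. ?s S' (steps_coeff r S S')))"
    by (intro sum.cong refl) (simp add: dots_times_mDelta_class_of[OF S])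
  also have "\<dots> = (\<Sum>S'\<in>subtrees. ?s S' (\<Sum>r\<le>?n. c r * steps_coeff r S S'))"
    by (simp add: smul_sum smul_single single_sum sum.swap[of _ subtrees])
  also have "\<dots> = (\<Sum>S'\<in>subtrees. ?s S' (pmf (binomial_model T0 q S) S' * weight S / weight S'))"
  proof (intro sum.cong refl arg_cong[where f = "?s _"])
    fix S'
    have "pmf (binomial_model T0 q S) S' =
        (\<Sum>r\<le>?n. pmf (fire_steps T0 r S) S' * pmf (binomial_pmf ?n (1 - q)) r)"
      unfolding binomial_model_eq[OF S q] pmf_bind
      by (rule integral_measure_pmf_real)
        (use q in \<open>auto simp: set_pmf_binomial_eq split: if_splits\<close>)
    also have "\<dots> * weight S / weight S' = (\<Sum>r\<le>?n. c r * steps_coeff r S S')"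
      unfolding sum_distrib_right sum_divide_distrib
      using q by (intro sum.cong refl) (simp add: steps_coeff_def c_def binomial_fact mult_ac)
    finally show "(\<Sum>r\<le>?n. c r * steps_coeff r S S') =
        pmf (binomial_model T0 q S) S' * weight S / weight S'" by simp
  qed
  finally show "BinT2R ?N q (bas (add_dots T0 S)) =
      (\<Sum>S'\<in>subtrees. ?s S' (pmf (binomial_model T0 q S) S' * weight S / weight S'))" .
qed

lemma Khat_support:
  assumes "driven_by T P" "S \<in> subtrees" "Khat T (add_dots T0 S) y \<noteq> 0"
  shows "y \<in> add_dots T0 ` subtrees"
proof (rule ccontr)
  assume "y \<notin> add_dots T0 ` subtrees"
  then have "Poly_Mapping.lookup (T (bas (add_dots T0 S))) y = 0"
    using assms(1,2) by (auto simp: driven_by_def lookup_sum lookup_single when_def intro!: sum.neutral)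
  then show False using assms(3) by (simp add: Khat_def)
qed

text \<open>Injectivity isolates the single summand at \<open>S'\<close>, and the quotient of
  \<open>eta\<close> values cancels its quotient of weights.\<close>

lemma Khat_eq_pmf:
  assumes "driven_by T P" "inj_on (add_dots T0) subtrees" "S \<in> subtrees" "S' \<in> subtrees"
  shows "Khat T (add_dots T0 S) (add_dots T0 S') = pmf (P S) S'"
proof -
  have "Poly_Mapping.lookup (T (bas (add_dots T0 S))) (add_dots T0 S') =
      (\<Sum>U\<in>subtrees. if U = S' then pmf (P S) S' * weight S / weight S' else 0)"
    using assms unfolding driven_by_def
    by (auto simp: lookup_sum lookup_single when_def inj_on_eq_iff intro!: sum.cong)
  also have "\<dots> = pmf (P S) S' * weight S / weight S'"
    using assms(4) finite_rooted_subtrees[OF rooted] by simp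
  finally show ?thesis
    using inv_hooks_pos[of "induced T0 S"] inv_hooks_pos[of "induced T0 S'"]
    by (simp add: Khat_def eta_add_dots assms)
qed

end

section \<open>Recovering a subtree from its isomorphism class\<close>

lift_definition labels :: "'l forest \<Rightarrow> 'l option set" is
  "\<lambda>F. lab F ` {v \<in> verts F. par F v \<noteq> None}"
proof -
  fix F G :: "'l dforest"
  assume "forest_iso F G"
  then obtain f where "forest_iso_by f F G" by (auto simp: forest_iso_def)
  then have f: "verts G = f ` verts F"
    "\<And>v. v \<in> verts F \<Longrightarrow> par G (f v) = map_option f (par F v)"
    "\<And>v. v \<in> verts F \<Longrightarrow> lab G (f v) = lab F v"
    by (auto simp: forest_iso_by_def bij_betw_def)
  have "{v \<in> verts G. par G v \<noteq> None} = f ` {v \<in> verts F. par F v \<noteq> None}"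
    unfolding f(1) using f(2) by auto
  then have "lab G ` {v \<in> verts G. par G v \<noteq> None} =
      (\<lambda>v. lab G (f v)) ` {v \<in> verts F. par F v \<noteq> None}"
    by (simp only: image_image)
  also have "\<dots> = lab F ` {v \<in> verts F. par F v \<noteq> None}"
    using f(3) by (intro image_cong) auto
  finally show "lab F ` {v \<in> verts F. par F v \<noteq> None} = lab G ` {v \<in> verts G. par G v \<noteq> None}" ..
qed

lemma labels_plus: "labels (x + y) = labels x \<union> labels y"
proof (transfer, goal_cases)
  case (1 F G)
  have "{v \<in> verts (disj_union F G). par (disj_union F G) v \<noteq> None} =
      (\<lambda>n. 2 * n) ` {v \<in> verts F. par F v \<noteq> None} \<union>
      (\<lambda>n. Suc (2 * n)) ` {v \<in> verts G. par G v \<noteq> None}"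
    unfolding disj_union_simps by (auto simp: disj_union_simps simp del: not_None_eq)
  then show ?case
    by (simp add: image_Un image_image disj_union_simps del: not_None_eq)
qed

lemma labels_dots: "labels (dots k) = {}"
proof (induction k)
  case 0
  have "labels 0 = {}" by transfer (simp add: empty_df_def)
  then show ?case by simp
next
  case (Suc k)
  have "labels dot = {}" by transfer (simp add: dot_df_def)
  then show ?case using Suc by (simp add: labels_plus)
qed

text \<open>The set of labels of non-root vertices is invariant under isomorphism and blind to added
  dots. Distinct labels recover the non-root vertices from it, and the root belongs to every
  subtree.\<close>

lemma (in company) inj_on_add_dots:
  assumes inj: "inj_on (lab T0) {v \<in> verts T0. par T0 v \<noteq> None}"
  shows "inj_on (add_dots T0) subtrees"
proof (rule inj_onI)
  fix S S' assume S: "S \<in> subtrees" "S' \<in> subtrees" and eq: "add_dots T0 S = add_dots T0 S'"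
  let ?nr = "\<lambda>S. {v \<in> S. par T0 v \<noteq> None}"
  have "labels (add_dots T0 U) = lab T0 ` ?nr U" if "U \<in> subtrees" for U
    using wf_induced[OF that]
    by (simp add: add_dots_def labels_plus labels_dots labels.abs_eq forest_iso_refl)
  from this[OF S(1)] this[OF S(2)] have "lab T0 ` ?nr S = lab T0 ` ?nr S'" by (simp only: eq)
  moreover have sub: "S \<subseteq> verts T0" "S' \<subseteq> verts T0" "root T0 \<in> S" "root T0 \<in> S'"
    using S by (auto simp: rooted_subtrees_def)
  moreover have "?nr S \<subseteq> {v \<in> verts T0. par T0 v \<noteq> None}" "?nr S' \<subseteq> {v \<in> verts T0. par T0 v \<noteq> None}"
    using sub by blast+
  ultimately have nr: "?nr S = ?nr S'"
    using inj_on_image_eq_iff[OF inj] by blast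
  have U: "U = insert (root T0) (?nr U)" if "U \<subseteq> verts T0" "root T0 \<in> U" for U
    using that rooted_tree_root(3)[OF rooted] by blast
  show "S = S'" using U[OF sub(1,3)] U[OF sub(2,4)] nr by simp
qed

theorem theorem5p2:
  fixes T0 :: "'l::finite dforest" and q2 :: real and n0 :: nat
    and States :: "'l forest set"
  assumes "rooted_tree T0"
    and "inj_on (lab T0) {v \<in> verts T0. par T0 v \<noteq> None}"
    and "n0 = card (verts T0)"
    and "0 \<le> q2" and "q2 \<le> 1"
    and "States = {sum_list (replicate (n0 - n) dot) + abs_forest (T0\<lparr>verts := S\<rparr>) | n S.
                    1 \<le> n \<and> n \<le> n0 \<and> S \<in> rooted_subtrees T0 \<and> card S = n}"
  shows "States \<subseteq> basis_deg n0 \<and> abs_forest T0 \<in> States \<and>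
    (\<forall>x\<in>States. \<forall>y\<in>basis_deg n0. Khat (T2R n0) x y \<noteq> 0 \<longrightarrow> y \<in> States) \<and>
    (\<forall>x\<in>States. \<forall>y\<in>basis_deg n0. Khat (BinT2R n0 q2) x y \<noteq> 0 \<longrightarrow> y \<in> States) \<and>
    bij_betw (add_dots T0) (rooted_subtrees T0) States \<and>
    add_dots T0 (verts T0) = abs_forest T0 \<and>
    (\<forall>S\<in>rooted_subtrees T0. set_pmf (single_model T0 S) \<subseteq> rooted_subtrees T0 \<and>
       set_pmf (binomial_model T0 q2 S) \<subseteq> rooted_subtrees T0) \<and>
    (\<forall>S\<in>rooted_subtrees T0. \<forall>S'\<in>rooted_subtrees T0.
       Khat (T2R n0) (add_dots T0 S) (add_dots T0 S') = pmf (single_model T0 S) S' \<and>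
       Khat (BinT2R n0 q2) (add_dots T0 S) (add_dots T0 S') = pmf (binomial_model T0 q2 S) S')"
proof -
  interpret company T0 by unfold_locales fact
  have States: "States = add_dots T0 ` subtrees"
  proof (intro equalityI subsetI)
    fix x assume "x \<in> States"
    then show "x \<in> add_dots T0 ` subtrees"
      unfolding assms(6) by (auto simp: add_dots_def assms(3))
  next
    fix x assume "x \<in> add_dots T0 ` subtrees"
    then obtain S where S: "S \<in> subtrees" "x = add_dots T0 S" by blast
    then have "1 \<le> card S" "card S \<le> n0"
      using card_subtree_pos[OF S(1)] card_subtree_le[OF S(1)] assms(3) by auto
    then show "x \<in> States"
      unfolding assms(6) using S by (auto simp: add_dots_def assms(3))
  qed
  note inj = inj_on_add_dots[OF assms(2)]
  note single = driven_by_T2R[folded assms(3)]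
  note binomial = driven_by_BinT2R[OF assms(4,5), folded assms(3)]
  have deg: "States \<subseteq> basis_deg n0"
    using card_subtree_le by (auto simp: States basis_deg_def add_dots_def deg_plus deg_class_of assms(3))
  have top: "add_dots T0 (verts T0) = abs_forest T0"
    by (simp add: add_dots_def)
  have start: "abs_forest T0 \<in> States"
    unfolding States top[symmetric] using verts_in_rooted_subtrees[OF assms(1)] by blast
  have closed: "set_pmf (single_model T0 S) \<subseteq> subtrees"
    "set_pmf (binomial_model T0 q2 S) \<subseteq> subtrees" if S: "S \<in> subtrees" for S
  proof -
    show "set_pmf (single_model T0 S) \<subseteq> subtrees"
      using set_fire_step[OF S] S unfolding single_model_eq[OF S] by (auto split: if_splits)
    show "set_pmf (binomial_model T0 q2 S) \<subseteq> subtrees"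
      using set_fire_steps[OF S] unfolding binomial_model_eq[OF S assms(4,5)] by auto
  qed
  have supp: "\<forall>x\<in>States. \<forall>y\<in>basis_deg n0. Khat (T2R n0) x y \<noteq> 0 \<longrightarrow> y \<in> States"
    "\<forall>x\<in>States. \<forall>y\<in>basis_deg n0. Khat (BinT2R n0 q2) x y \<noteq> 0 \<longrightarrow> y \<in> States"
    unfolding States using Khat_support[OF single] Khat_support[OF binomial] by blast+
  have "bij_betw (add_dots T0) subtrees States"
    using inj by (simp add: bij_betw_def States)
  moreover have "\<forall>S\<in>subtrees. \<forall>S'\<in>subtrees.
      Khat (T2R n0) (add_dots T0 S) (add_dots T0 S') = pmf (single_model T0 S) S' \<and>
      Khat (BinT2R n0 q2) (add_dots T0 S) (add_dots T0 S') = pmf (binomial_model T0 q2 S) S'"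
    by (intro ballI conjI Khat_eq_pmf[OF single inj] Khat_eq_pmf[OF binomial inj])
  moreover have "\<forall>S\<in>subtrees. set_pmf (single_model T0 S) \<subseteq> subtrees \<and>
      set_pmf (binomial_model T0 q2 S) \<subseteq> subtrees"
    by (intro ballI conjI closed)
  ultimately show ?thesis
    using deg start supp top by (intro conjI)
qed

end
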